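(* Let $k\ge2$ be an integer, let $T$ be the infinite rooted $k$-ary tree, let $1<p<\infty$, and let $w$ be a weight on $T$ such that there exists a real number $\delta<1$ such that for all integers $i,j,r\ge 0$ with $|i-j|\le r$ and all $x\in T_j$, $$w(T_i\cap S(x,r))\lesssim k^{\frac{r+i-j}{2}(p-\delta)}\,k^{r\delta}\,w(x).$$ Then for all functions $f$ on $T$ $$\|Mf\|_{L^{p,\infty}(w)}\lesssim\|f\|_{L^{p}(w)}.$$ Furthermore, if $p<q<\infty$, then for all functions $f$ on $T$ $$\|Mf\|_{L^{q}(w)}\lesssim\|f\|_{L^{q}(w)}\qquad\text{and}\qquad\|Mf\|_{L^{q'}(\sigma_{q})}\lesssim\|f\|_{L^{q'}(\sigma_{q})},$$ where $\sigma_{q}=w^{-\frac{1}{q-1}}$ and $q'=\frac{q}{q-1}$.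
   Context: For an integer $k\ge2$, $T$ denotes (the vertex set of) the infinite rooted $k$-ary tree, in which every vertex has exactly $k$ children; $d(x,y)$ is the number of edges on the unique path between $x$ and $y$. $T_0$ is the set consisting of the root, and $T_j$ is the set of children of vertices in $T_{j-1}$ for $j\ge1$. $|A|$ is the cardinality of $A$, $B(x,r)=\{y\in T: d(x,y)\le r\}$ and $S(x,r)=\{y\in T:d(x,y)=r\}$. The centered maximal function is $Mf(x)=\sup_{r\in\mathbb{N}\cup\{0\}}\frac{1}{|B(x,r)|}\sum_{y\in B(x,r)}|f(y)|$. A weight is a function $w:T\to(0,\infty)$, and $w(A)=\sum_{x\in A}w(x)$ for $A\subset T$. For $0<q<\infty$, $\|f\|_{L^q(w)}=\left(\sum_{x\in T}|f(x)|^q w(x)\right)^{1/q}$ and $\|f\|_{L^{q,\infty}(w)}=\sup_{\lambda>0}\lambda\, w(\{x\in T:|f(x)|>\lambda\})^{1/q}$. The notation $A\lesssim B$ means $A\le CB$ for a finite constant $C$ independent of the varying objects (in the hypothesis: of $x,i,j,r$; in the conclusions: of $f$). *)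

theory Defs
  imports "HOL-Analysis.Analysis" "HOL-Library.Sublist"
begin

section \<open>The infinite rooted k-ary tree\<close>

text \<open>
  A vertex is the list of child labels read along the path from it up to the root:
  the root is the empty list, and the children of \<open>x\<close> are the lists \<open>a # x\<close> with \<open>a < k\<close>.
\<close>

definition tree :: "nat \<Rightarrow> nat list set" where
  "tree k = lists {..<k}"

definition children :: "nat \<Rightarrow> nat list \<Rightarrow> nat list set" where
  "children k x = (\<lambda>a. a # x) ` {..<k}"

primrec level :: "nat \<Rightarrow> nat \<Rightarrow> nat list set" where
  "level k 0 = {[]}"
| "level k (Suc j) = (\<Union>x\<in>level k j. children k x)"

definition tree_adj :: "nat \<Rightarrow> nat list \<Rightarrow> nat list \<Rightarrow> bool" where
  "tree_adj k x y \<longleftrightarrow> y \<in> children k x \<or> x \<in> children k y"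

definition tree_path :: "nat \<Rightarrow> nat list \<Rightarrow> nat list \<Rightarrow> nat list list \<Rightarrow> bool" where
  "tree_path k x y p \<longleftrightarrow>
     p \<noteq> [] \<and> distinct p \<and> set p \<subseteq> tree k \<and> hd p = x \<and> last p = y \<and> successively (tree_adj k) p"

text \<open>
  The distance counts edges, i.e. one less than the number of vertices, on the unique path;
  \<open>tree_path_unique\<close> below shows that the description is well defined on the tree.
\<close>

definition tree_dist :: "nat \<Rightarrow> nat list \<Rightarrow> nat list \<Rightarrow> nat" where
  "tree_dist k x y = length (THE p. tree_path k x y p) - 1"

lemma tree_adj_sym: "tree_adj k x y \<longleftrightarrow> tree_adj k y x"
  by (auto simp: tree_adj_def)

lemma tree_path_rev:
  assumes "tree_path k x y p"
  shows "tree_path k y x (rev p)"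
proof -
  have "successively (\<lambda>u v. tree_adj k v u) p"
    using assms by (auto simp: tree_path_def tree_adj_sym elim: successively_mono)
  then show ?thesis
    using assms by (simp add: tree_path_def hd_rev last_rev)
qed

lemma tree_path_step:
  assumes p: "tree_path k x' y p" and x: "x \<in> tree k" and adj: "tree_adj k x x'"
  shows "\<exists>q. tree_path k x y q"
proof (cases "x \<in> set p")
  case True
  then obtain as bs where "p = as @ x # bs"
    by (meson split_list)
  with p have "tree_path k x y (x # bs)"
    by (auto simp: tree_path_def successively_append_iff)
  then show ?thesis ..
next
  case False
  with p x adj have "tree_path k x y (x # p)"
    by (auto simp: tree_path_def successively_Cons)
  then show ?thesis ..
qed

lemma tree_path_to_root: "x \<in> tree k \<Longrightarrow> \<exists>p. tree_path k x [] p"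
proof (induction x)
  case Nil
  have "tree_path k [] [] [[]]"
    by (simp add: tree_path_def tree_def)
  then show ?case ..
next
  case (Cons a x)
  then obtain p where "tree_path k x [] p"
    by (auto simp: tree_def)
  moreover have "tree_adj k (a # x) x"
    using Cons.prems by (auto simp: tree_adj_def children_def tree_def)
  ultimately show ?case
    using Cons.prems tree_path_step by blast
qed

lemma tree_path_exists: "x \<in> tree k \<Longrightarrow> y \<in> tree k \<Longrightarrow> \<exists>p. tree_path k x y p"
proof (induction x)
  case Nil
  then show ?case
    using tree_path_to_root tree_path_rev by blast
next
  case (Cons a x)
  then obtain p where "tree_path k x y p"
    by (auto simp: tree_def)
  moreover have "tree_adj k (a # x) x"
    using Cons.prems by (auto simp: tree_adj_def children_def tree_def)
  ultimately show ?case
    using Cons.prems tree_path_step by blast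
qed

lemma path_stays_in_subtree:
  assumes "successively (tree_adj k) p" "p \<noteq> []" "x \<notin> set p" "suffix (b # x) (hd p)"
  shows "suffix (b # x) (last p)"
  using assms
proof (induction p)
  case (Cons u p)
  show ?case
  proof (cases "p = []")
    case False
    then have "tree_adj k u (hd p)" "hd p \<noteq> x"
      using Cons.prems by (auto simp: successively_Cons)
    then have "suffix (b # x) (hd p)"
      using Cons.prems(4) by (auto simp: tree_adj_def children_def suffix_Cons)
    then show ?thesis
      using Cons False by (auto simp: successively_Cons)
  qed (use Cons in auto)
qed auto

lemma path_stays_outside_subtree:
  assumes "successively (tree_adj k) p" "p \<noteq> []" "x \<notin> set p" "\<not> suffix x (hd p)"
  shows "\<not> suffix x (last p)"
  using assms
proof (induction p)
  case (Cons u p)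
  show ?case
  proof (cases "p = []")
    case False
    then have "tree_adj k u (hd p)" "hd p \<noteq> x"
      using Cons.prems by (auto simp: successively_Cons)
    then have "\<not> suffix x (hd p)"
      using Cons.prems(4) by (auto simp: tree_adj_def children_def suffix_Cons)
    then show ?thesis
      using Cons False by (auto simp: successively_Cons)
  qed (use Cons in auto)
qed auto

lemma tree_path_inj:
  "tree_path k x y p \<Longrightarrow> tree_path k x y q \<Longrightarrow> p = q"
proof (induction p arbitrary: x q)
  case Nil
  then show ?case by (simp add: tree_path_def)
next
  case (Cons u p)
  obtain v q' where q: "q = v # q'"
    using Cons.prems(2) by (cases q) (auto simp: tree_path_def)
  have uv: "u = x" "v = x"
    using Cons.prems q by (auto simp: tree_path_def)
  show ?case
  proof (cases "x = y")
    case True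
    have "r = []" if "tree_path k x y (x # r)" for r
      using that True by (cases r rule: rev_cases) (auto simp: tree_path_def)
    then show ?thesis
      using Cons.prems q uv by metis
  next
    case False
    have step: "r \<noteq> [] \<and> tree_path k (hd r) y r \<and>
        (if suffix x y then suffix (hd r) y \<and> hd r \<in> children k x else x \<in> children k (hd r))"
      if r: "tree_path k x y (x # r)" for r
    proof -
      have ne: "r \<noteq> []"
        using r False by (auto simp: tree_path_def)
      then have r': "successively (tree_adj k) r" "x \<notin> set r" "last r = y"
          "tree_adj k x (hd r)" "tree_path k (hd r) y r"
        using r by (auto simp: tree_path_def successively_Cons)
      have down: "suffix (hd r) y" if c: "hd r \<in> children k x"
      proof -
        obtain b where "hd r = b # x"
          using c by (auto simp: children_def)
        then show ?thesis
          using path_stays_in_subtree[of k r x b] r' ne by auto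
      qed
      have up: "\<not> suffix x y" if c: "x \<in> children k (hd r)"
      proof -
        have "\<not> suffix x (hd r)"
          using c by (auto simp: children_def suffix_def)
        then show ?thesis
          using path_stays_outside_subtree[of k r x] r' ne by auto
      qed
      have "suffix x y" if c: "hd r \<in> children k x"
        using down[OF c] c by (auto simp: children_def dest: suffix_ConsD)
      then show ?thesis
        using ne r' down up by (auto simp: tree_adj_def)
    qed
    have sp: "r \<noteq> [] \<and> tree_path k (hd r) y r" if "r = p \<or> r = q'" for r
      using that step Cons.prems q uv by auto
    have "hd p = hd q'"
    proof (cases "suffix x y")
      case True
      then have s: "suffix (hd p) y" "suffix (hd q') y"
        and c: "hd p \<in> children k x" "hd q' \<in> children k x"
        using step[of p] step[of q'] Cons.prems q uv by auto
      have "length (hd p) = length (hd q')"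
        using c by (auto simp: children_def)
      then show ?thesis
        using s suffix_length_suffix[of "hd p" y "hd q'"] suffix_length_suffix[of "hd q'" y "hd p"]
        by (simp add: suffix_order.antisym)
    next
      case False
      then show ?thesis
        using step[of p] step[of q'] Cons.prems q uv by (auto simp: children_def)
    qed
    then have "p = q'"
      using Cons.IH[of "hd p" q'] sp[of p] sp[of q'] by auto
    then show ?thesis
      using q uv by simp
  qed
qed

lemma tree_path_unique: "x \<in> tree k \<Longrightarrow> y \<in> tree k \<Longrightarrow> \<exists>!p. tree_path k x y p"
  using tree_path_exists tree_path_inj by blast

definition tree_ball :: "nat \<Rightarrow> nat list \<Rightarrow> nat \<Rightarrow> nat list set" where
  "tree_ball k x r = {y \<in> tree k. tree_dist k x y \<le> r}"

lemma level_eq: "level k j = {x \<in> tree k. length x = j}"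
proof (induction j)
  case 0
  then show ?case by (auto simp: tree_def)
next
  case (Suc j)
  have "y \<in> (\<Union>x\<in>{x \<in> tree k. length x = j}. children k x)
      \<longleftrightarrow> y \<in> tree k \<and> length y = Suc j" for y
    by (cases y) (auto simp: children_def tree_def image_iff)
  then show ?case
    by (auto simp: Suc.IH)
qed

lemma path_length_bound:
  "successively (tree_adj k) p \<Longrightarrow> p \<noteq> [] \<Longrightarrow> length (last p) < length (hd p) + length p"
proof (induction p)
  case (Cons u p)
  show ?case
  proof (cases "p = []")
    case False
    then have "tree_adj k u (hd p)" "length (last p) < length (hd p) + length p"
      using Cons by (auto simp: successively_Cons)
    moreover from this(1) have "length (hd p) \<le> Suc (length u)"
      by (auto simp: tree_adj_def children_def)
    ultimately show ?thesis
      using False by simp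
  qed simp
qed simp

lemma finite_tree_ball:
  assumes x: "x \<in> tree k"
  shows "finite (tree_ball k x r)"
proof (rule finite_subset)
  show "tree_ball k x r \<subseteq> {y. set y \<subseteq> {..<k} \<and> length y \<le> length x + r}"
  proof
    fix y assume "y \<in> tree_ball k x r"
    then have y: "y \<in> tree k" "tree_dist k x y \<le> r"
      by (auto simp: tree_ball_def)
    have p: "tree_path k x y (THE p. tree_path k x y p)" (is "tree_path k x y ?p")
      using tree_path_unique[OF x y(1)] by (rule theI')
    then have "length y < length x + length ?p"
      using path_length_bound[of k ?p] by (auto simp: tree_path_def)
    then show "y \<in> {y. set y \<subseteq> {..<k} \<and> length y \<le> length x + r}"
      using y by (auto simp: tree_dist_def tree_def)
  qed
qed (simp add: finite_lists_length_le)

definition tree_sphere :: "nat \<Rightarrow> nat list \<Rightarrow> nat \<Rightarrow> nat list set" where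
  "tree_sphere k x r = {y \<in> tree k. tree_dist k x y = r}"

section \<open>Maximal function and weighted norms\<close>

text \<open>
  Functions on the tree are functions on \<open>nat list\<close> of which only the values on \<open>tree k\<close> matter.
  The maximal function and the norms may be infinite, hence take values in \<open>ennreal\<close>.
\<close>

definition maximal_fun :: "nat \<Rightarrow> (nat list \<Rightarrow> complex) \<Rightarrow> nat list \<Rightarrow> ennreal" where
  "maximal_fun k f x =
     (SUP r. ennreal ((\<Sum>y\<in>tree_ball k x r. norm (f y)) / real (card (tree_ball k x r))))"

definition is_weight :: "nat \<Rightarrow> (nat list \<Rightarrow> real) \<Rightarrow> bool" where
  "is_weight k w \<longleftrightarrow> (\<forall>x\<in>tree k. 0 < w x)"

text \<open>Sums of non-negative extended reals are integrals with respect to counting measure.\<close>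

definition weight_of :: "(nat list \<Rightarrow> real) \<Rightarrow> nat list set \<Rightarrow> ennreal" where
  "weight_of w A = (\<integral>\<^sup>+x. ennreal (w x) \<partial>count_space A)"

text \<open>Powers of extended non-negative reals; used for positive exponents only.\<close>

definition ennpowr :: "ennreal \<Rightarrow> real \<Rightarrow> ennreal" where
  "ennpowr a q = (if a = \<infinity> then \<infinity> else ennreal (enn2real a powr q))"

definition Lq_norm :: "nat \<Rightarrow> real \<Rightarrow> (nat list \<Rightarrow> real) \<Rightarrow> (nat list \<Rightarrow> ennreal) \<Rightarrow> ennreal" where
  "Lq_norm k q w g =
     ennpowr (\<integral>\<^sup>+x. ennpowr (g x) q * ennreal (w x) \<partial>count_space (tree k)) (1 / q)"

definition weak_Lq_norm ::
  "nat \<Rightarrow> real \<Rightarrow> (nat list \<Rightarrow> real) \<Rightarrow> (nat list \<Rightarrow> ennreal) \<Rightarrow> ennreal" where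
  "weak_Lq_norm k q w g =
     (SUP l\<in>{0<..}. ennreal l * ennpowr (weight_of w {x \<in> tree k. g x > ennreal l}) (1 / q))"

end

theory Submission
  imports Defs
begin

text \<open>
  If the paths from \<open>x\<close> and from \<open>y\<close> towards the root meet at \<open>z\<close>, at heights \<open>b\<close> above \<open>x\<close> and
  \<open>a\<close> above \<open>y\<close>, then \<open>d(x,y) = a + b\<close>.  Since \<open>|B(x,r)| \<ge> k^r\<close>, the maximal function is bounded by
  a geometrically weighted sum over \<open>(a, b)\<close> of the averages \<open>U f(x) = k^(-(a+b)) \<Sum> f(y)\<close>, with \<open>y\<close>
  ranging over the vertices \<open>a\<close> levels below the \<open>b\<close>-th ancestor of \<open>x\<close>.  The hypothesis on \<open>w\<close> says
  that for \<open>y\<close> lying \<open>a\<close> levels below \<open>z\<close> the weight of the vertices \<open>b\<close> levels below \<open>z\<close> is at most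
  \<open>C k^(b p + a \<delta>) w(y)\<close>.  By Jensen's inequality \<open>U\<close> has norm at most
  \<open>C k^(-(b (q - p) + a (1 - \<delta>)) / q)\<close> on \<open>L^q(w)\<close>, and by Hoelder's inequality with weight \<open>w\<close> it has
  geometric decay on \<open>L^q'(\<sigma>)\<close> too, with the roles of \<open>a\<close> and \<open>b\<close> exchanged.  Both decays are summable
  for \<open>q > p\<close>.  At the endpoint \<open>q = p\<close> the decay in \<open>b\<close> is lost; there, for fixed \<open>z\<close>, only those \<open>b\<close>
  contribute to the level set for which \<open>k^b\<close> is below the average at \<open>z\<close> divided by the level, and
  the geometric sum of \<open>k^(b p)\<close> over these \<open>b\<close> gives the weak type bound.
\<close>

section \<open>Meeting points and descendants\<close>

lemma level_tree_iff: "x \<in> level k j \<longleftrightarrow> x \<in> tree k \<and> length x = j"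
  by (simp add: level_eq)

lemma countable_tree: "countable (tree k)"
  by (rule countableI_type)

lemma Cons_in_tree: "a # z \<in> tree k \<longleftrightarrow> a < k \<and> z \<in> tree k"
  by (auto simp: tree_def)

lemma tree_dist_eqI:
  assumes "tree_path k x y p"
  shows "tree_dist k x y = length p - 1"
proof -
  have "(THE p. tree_path k x y p) = p"
    using assms tree_path_inj by blast
  then show ?thesis
    by (simp add: tree_dist_def)
qed

text \<open>The inclusion for \<open>set p\<close> shows, when a path is extended, that the new vertex is not yet on it.\<close>

definition meets_at :: "nat \<Rightarrow> nat list \<Rightarrow> nat list \<Rightarrow> nat list \<Rightarrow> bool" where
  "meets_at k u v z \<longleftrightarrow> (\<exists>p. tree_path k (u @ z) (v @ z) p \<and>
     set p \<subseteq> {s @ z | s. suffix s u \<or> suffix s v} \<and> length p = length u + length v + 1)"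

lemma meets_at_sym: "meets_at k u v z \<Longrightarrow> meets_at k v u z"
proof -
  assume "meets_at k u v z"
  then obtain p where "tree_path k (u @ z) (v @ z) p"
     "set p \<subseteq> {s @ z | s. suffix s u \<or> suffix s v}" "length p = length u + length v + 1"
    unfolding meets_at_def by blast
  then show ?thesis
    unfolding meets_at_def by (intro exI[of _ "rev p"]) (auto intro: tree_path_rev)
qed

text \<open>The path grows by one vertex at its end \<open>u @ z\<close>. The new vertex is not on
  it: \<open>c # u\<close> is too long to be a suffix of \<open>u\<close>, and as a suffix of
  \<open>v\<close> it would make the last labels agree.\<close>

lemma meets_at_Cons:
  assumes m: "meets_at k u v z" and x: "c # u @ z \<in> tree k"
    and fork: "v = [] \<or> last (c # u) \<noteq> last v"
  shows "meets_at k (c # u) v z"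
proof -
  obtain p where p: "tree_path k (u @ z) (v @ z) p"
     "set p \<subseteq> {s @ z | s. suffix s u \<or> suffix s v}" "length p = length u + length v + 1"
    using m unfolding meets_at_def by blast
  have "c # u @ z \<notin> set p"
  proof
    assume "c # u @ z \<in> set p"
    then obtain s where s: "c # u @ z = s @ z" "suffix s u \<or> suffix s v"
      using p(2) by auto
    then have s': "s = c # u"
      by (metis append_Cons append_same_eq)
    have "\<not> suffix s u"
      using s' suffix_length_le[of s u] by auto
    then obtain t where "v = t @ c # u"
      using s(2) s' by (auto simp: suffix_def)
    then show False
      using fork by auto
  qed
  have "tree_adj k (c # u @ z) (u @ z)"
    using x by (auto simp: tree_adj_def children_def tree_def)
  have "tree_path k ((c # u) @ z) (v @ z) ((c # u @ z) # p)"
    using p(1) x \<open>c # u @ z \<notin> set p\<close> \<open>tree_adj k (c # u @ z) (u @ z)\<close>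
    by (auto simp: tree_path_def successively_Cons)
  moreover have "set ((c # u @ z) # p) \<subseteq> {s @ z | s. suffix s (c # u) \<or> suffix s v}"
    using p(2) by (auto simp: suffix_Cons)
  ultimately show ?thesis
    unfolding meets_at_def using p(3) by (intro exI[of _ "(c # u @ z) # p"]) auto
qed

lemma meets_at_Nil:
  assumes "u @ z \<in> tree k"
  shows "meets_at k u [] z"
  using assms
proof (induction u)
  case Nil
  then have "tree_path k z z [z]"
    by (simp add: tree_path_def)
  then show ?case
    unfolding meets_at_def by (intro exI[of _ "[z]"]) auto
next
  case (Cons c u)
  then show ?case
    by (intro meets_at_Cons) (auto simp: Cons_in_tree)
qed

text \<open>Labels are read upwards, so \<open>last u\<close> and \<open>last v\<close> name the
  children of \<open>z\<close> through which the two branches start. If they differ,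
  \<open>z\<close> is the lowest common ancestor.\<close>

lemma meets_at_fork:
  assumes "u @ z \<in> tree k" "v @ z \<in> tree k" "u = [] \<or> v = [] \<or> last u \<noteq> last v"
  shows "meets_at k u v z"
  using assms
proof (induction u)
  case Nil
  then show ?case
    by (intro meets_at_sym[OF meets_at_Nil]) auto
next
  case (Cons c u)
  have "meets_at k u v z"
    using Cons by (cases "u = []") (auto simp: Cons_in_tree)
  then show ?case
    using Cons.prems by (intro meets_at_Cons) auto
qed

lemma tree_dist_fork:
  assumes "u @ z \<in> tree k" "v @ z \<in> tree k" "u = [] \<or> v = [] \<or> last u \<noteq> last v"
  shows "tree_dist k (u @ z) (v @ z) = length u + length v"
  using meets_at_fork[OF assms] by (auto simp: meets_at_def tree_dist_eqI)

text \<open>Reversed, \<open>z\<close> is the longest common prefix of the two reversed lists; it is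
  the lowest common ancestor.\<close>

lemma fork_exists:
  fixes x y :: "'a list"
  shows "\<exists>u v z. x = u @ z \<and> y = v @ z \<and> (u = [] \<or> v = [] \<or> last u \<noteq> last v)"
proof -
  obtain ps xs' ys' where *: "rev x = ps @ xs'" "rev y = ps @ ys'"
      "xs' = [] \<or> ys' = [] \<or> hd xs' \<noteq> hd ys'"
    using longest_common_prefix[of "rev x" "rev y"] by auto
  then have "x = rev xs' @ rev ps" "y = rev ys' @ rev ps"
    by (metis rev_append rev_rev_ident)+
  then show ?thesis
    using *(3) by (intro exI[of _ "rev xs'"] exI[of _ "rev ys'"] exI[of _ "rev ps"])
      (auto simp: last_rev)
qed

section \<open>Generations below a vertex and the covering of balls\<close>

definition descend :: "nat \<Rightarrow> nat \<Rightarrow> nat list \<Rightarrow> nat list set" where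
  "descend k a z = (\<lambda>v. v @ z) ` {v. set v \<subseteq> {..<k} \<and> length v = a}"

lemma finite_descend [simp]: "finite (descend k a z)"
  by (simp add: descend_def finite_lists_length_eq)

lemma card_descend: "card (descend k a z) = k ^ a"
  unfolding descend_def
  by (subst card_image) (auto simp: inj_on_def card_lists_length_eq)

text \<open>\<open>drop b x\<close> is the \<open>b\<close>-th ancestor of \<open>x\<close>. The
  bound on \<open>b\<close> excludes lists that are too short, for which \<open>drop\<close> would
  return the root.\<close>

lemma descend_tree_iff:
  assumes "z \<in> tree k"
  shows "x \<in> descend k b z \<longleftrightarrow> x \<in> tree k \<and> b \<le> length x \<and> drop b x = z"
proof
  assume "x \<in> descend k b z"
  then show "x \<in> tree k \<and> b \<le> length x \<and> drop b x = z"
    using assms by (auto simp: descend_def tree_def)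
next
  assume x: "x \<in> tree k \<and> b \<le> length x \<and> drop b x = z"
  then have "take b x @ z = x" "length (take b x) = b" "set (take b x) \<subseteq> {..<k}"
    using append_take_drop_id[of b x] set_take_subset[of b x] by (auto simp: tree_def)
  then show "x \<in> descend k b z"
    unfolding descend_def by (metis (mono_tags, lifting) image_eqI mem_Collect_eq)
qed

lemma descend_subset_tree: "z \<in> tree k \<Longrightarrow> descend k b z \<subseteq> tree k"
  using descend_tree_iff by blast

lemma drop_in_tree: "x \<in> tree k \<Longrightarrow> drop b x \<in> tree k"
  using set_drop_subset[of b x] by (auto simp: tree_def)

text \<open>All \<open>k ^ r\<close> descendants of \<open>x\<close> that lie \<open>r\<close>
  levels below it have distance exactly \<open>r\<close>.\<close>

lemma card_ball_ge:
  assumes "x \<in> tree k"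
  shows "k ^ r \<le> card (tree_ball k x r)"
proof -
  have "descend k r x \<subseteq> tree_ball k x r"
  proof
    fix y assume "y \<in> descend k r x"
    then obtain v where v: "y = v @ x" "set v \<subseteq> {..<k}" "length v = r"
      by (auto simp: descend_def)
    then have "y \<in> tree k"
      using assms by (auto simp: tree_def)
    then show "y \<in> tree_ball k x r"
      using tree_dist_fork[of "[]" x k v] assms v by (auto simp: tree_ball_def)
  qed
  then show ?thesis
    using card_mono[OF finite_tree_ball[OF assms]] card_descend by metis
qed

text \<open>Take for \<open>a\<close> and \<open>b\<close> the heights of the meeting point above
  \<open>y\<close> and above \<open>x\<close>. The sets overlap, which is harmless for upper bounds
  on sums of nonnegative functions.\<close>

lemma tree_ball_cover:
  assumes "x \<in> tree k"
  shows "tree_ball k x r \<subseteq>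
    (\<Union>(a, b)\<in>{(a, b). a + b \<le> r \<and> b \<le> length x}. descend k a (drop b x))"
proof
  fix y assume y: "y \<in> tree_ball k x r"
  obtain u v z where *: "x = u @ z" "y = v @ z" "u = [] \<or> v = [] \<or> last u \<noteq> last v"
    using fork_exists by blast
  then have "length v + length u \<le> r"
    using y assms tree_dist_fork[of u z k v] by (auto simp: tree_ball_def)
  moreover have "y \<in> descend k (length v) (drop (length u) x)"
    using * y by (auto simp: descend_def tree_ball_def tree_def)
  ultimately show "y \<in> (\<Union>(a, b)\<in>{(a, b). a + b \<le> r \<and> b \<le> length x}. descend k a (drop b x))"
    using *(1) by (intro UN_I[of "(length v, length u)"]) auto
qed

section \<open>Growth of the weight between generations\<close>

lemma weight_of_finite:
  assumes "finite A" "A \<subseteq> tree k" "is_weight k w"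
  shows "weight_of w A = ennreal (\<Sum>x\<in>A. w x)"
proof -
  have "\<And>x. x \<in> A \<Longrightarrow> 0 \<le> w x"
    using assms(2,3) by (force simp: is_weight_def)
  then show ?thesis
    using assms(1) by (simp add: weight_of_def nn_integral_count_space_finite sum_ennreal)
qed

text \<open>The spherical hypothesis with \<open>i = length z + b\<close>,
  \<open>j = length z + a\<close>, \<open>r = a + b\<close>: then
  \<open>(r + i - j) / 2 = b\<close>, and the exponent is
  \<open>b * (p - \<delta>) + (a + b) * \<delta>\<close>. Whole generations replace the spheres, so
  no fork condition remains and the roles of \<open>a\<close> and \<open>b\<close> can be
  exchanged.\<close>

definition tree_growth ::
  "nat \<Rightarrow> real \<Rightarrow> real \<Rightarrow> real \<Rightarrow> (nat list \<Rightarrow> real) \<Rightarrow> bool" where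
  "tree_growth k p \<delta> C w \<longleftrightarrow> (\<forall>a b z y. z \<in> tree k \<longrightarrow> y \<in> descend k a z \<longrightarrow>
     (\<Sum>x\<in>descend k b z. w x) \<le> C * real k powr (real b * p + real a * \<delta>) * w y)"

text \<open>The sphere of radius \<open>a + b\<close> around \<open>y\<close> meets only those branches below \<open>z\<close> that do not contain
  \<open>y\<close>.  The remaining branch is an instance with \<open>a - 1\<close> and \<open>b - 1\<close>, whose bound is smaller by a factor
  \<open>k powr (p + \<delta>) \<ge> 2\<close>.\<close>

lemma tree_growthI:
  fixes \<delta> p C :: real
  assumes k: "2 \<le> k" and p: "1 < p" and w: "is_weight k w" and \<delta>: "0 \<le> \<delta>" and C: "0 \<le> C"
    and hyp: "\<And>i j r x. \<bar>int i - int j\<bar> \<le> int r \<Longrightarrow> x \<in> level k j \<Longrightarrow>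
           weight_of w (level k i \<inter> tree_sphere k x r)
              \<le> ennreal (C * real k powr ((real r + real i - real j) / 2 * (p - \<delta>))
                           * real k powr (real r * \<delta>) * w x)"
  shows "tree_growth k p \<delta> (2 * C) w"
proof -
  let ?D = "descend k"
  have sphere: "(\<Sum>x\<in>A. w x) \<le> C * real k powr (real b * p + real a * \<delta>) * w y"
    if z: "z \<in> tree k" and y: "y \<in> ?D a z" and A: "A \<subseteq> ?D b z"
      and s: "\<And>x. x \<in> A \<Longrightarrow> tree_dist k y x = a + b" for a b z y A
  proof -
    let ?L = "level k (length z + b) \<inter> tree_sphere k y (a + b)"
    have yt: "y \<in> tree k" and ly: "length y = length z + a"
      using y z descend_tree_iff[OF z] by (auto simp: descend_def)
    have fin: "finite ?L"
      by (rule finite_subset[OF _ finite_tree_ball[OF yt, of "a + b"]])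
        (auto simp: tree_sphere_def tree_ball_def)
    have wpos: "0 < w x" if "x \<in> tree k" for x
      using w that by (auto simp: is_weight_def)
    have sub: "A \<subseteq> ?L"
    proof
      fix x assume x: "x \<in> A"
      then have "x \<in> tree k" "length x = length z + b"
        using A descend_subset_tree[OF z, of b] by (auto simp: descend_def)
      then show "x \<in> ?L"
        using s[OF x] by (auto simp: level_tree_iff tree_sphere_def)
    qed
    have "ennreal (\<Sum>x\<in>?L. w x) = weight_of w ?L"
      by (rule weight_of_finite[symmetric, OF fin _ w]) (auto simp: tree_sphere_def)
    also have "\<dots> \<le> ennreal (C * real k powr ((real (a+b) + real (length z + b) - real (length y)) / 2 * (p - \<delta>))
                           * real k powr (real (a+b) * \<delta>) * w y)"
      by (rule hyp) (use yt ly in \<open>auto simp: level_tree_iff\<close>)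
    also have "(real (a+b) + real (length z + b) - real (length y)) / 2 * (p - \<delta>) = real b * (p - \<delta>)"
      using ly by simp
    also have "C * real k powr (real b * (p - \<delta>)) * real k powr (real (a+b) * \<delta>) * w y
       = C * real k powr (real b * p + real a * \<delta>) * w y"
      by (simp add: powr_add[symmetric] algebra_simps)
    finally have "(\<Sum>x\<in>?L. w x) \<le> C * real k powr (real b * p + real a * \<delta>) * w y"
      using C wpos[OF yt] by (subst (asm) ennreal_le_iff) auto
    moreover have "(\<Sum>x\<in>A. w x) \<le> (\<Sum>x\<in>?L. w x)"
      using sub fin wpos by (intro sum_mono2) (auto simp: tree_sphere_def less_imp_le)
    ultimately show ?thesis by simp
  qed
  have dbl: "X \<le> 2 * C * t * v" if "X \<le> C * t * v" "0 \<le> t" "0 < v" for X t v :: real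
  proof -
    have "0 \<le> C * t * v"
      using that C by simp
    then show ?thesis
      using that(1) by simp
  qed
  have main: "(\<Sum>x\<in>?D b z. w x) \<le> 2 * C * real k powr (real b * p + real a * \<delta>) * w y"
    if z: "z \<in> tree k" and y: "y \<in> ?D a z" for a b z y
    using that
  \<comment> \<open>\<open>y\<close> stays fixed while \<open>z\<close> moves down towards
    it.\<close>
  proof (induction a arbitrary: b z)
    case (0 b z)
    have "w y > 0"
      using 0 w descend_subset_tree[OF 0(1), of 0] by (auto simp: is_weight_def)
    have "tree_dist k y x = 0 + b" if "x \<in> ?D b z" for x
    proof -
      have "y = z" using 0 by (auto simp: descend_def)
      then show ?thesis
        using that 0(1) tree_dist_fork[of "[]" z k "take b x"] descend_tree_iff[OF 0(1), of x b]
        by (auto simp: append_take_drop_id)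
    qed
    from sphere[OF 0 subset_refl this] show ?case
      by (rule dbl) (use \<open>w y > 0\<close> in auto)
  next
    case (Suc a b z)
    have wy: "w y > 0"
      using Suc.prems w descend_subset_tree[OF Suc.prems(1)] by (auto simp: is_weight_def)
    obtain u' where u': "y = u' @ z" "set u' \<subseteq> {..<k}" "length u' = Suc a"
      using Suc.prems(2) by (auto simp: descend_def)
    \<comment> \<open>\<open>c\<close> is the label next to \<open>z\<close>, so
      \<open>c # z\<close> is the child of \<open>z\<close> on the way to \<open>y\<close>.\<close>
    define u c where "u = butlast u'" and "c = last u'"
    have "u' = u @ [c]"
      using u'(3) unfolding u_def c_def by (metis append_butlast_last_id list.size(3) nat.distinct(1))
    with u' have u: "y = u @ c # z" "set u \<subseteq> {..<k}" "length u = a" "c < k"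
      by auto
    have cz: "c # z \<in> tree k"
      using u Suc.prems by (auto simp: Cons_in_tree)
    have ycz: "y \<in> ?D a (c # z)"
      using u by (auto simp: descend_def)
    show ?case
    proof (cases b)
      case 0
      have "tree_dist k y x = Suc a + b" if "x \<in> ?D b z" for x
      proof -
        have "x = z" using that 0 by (auto simp: descend_def)
        then show ?thesis
          using tree_dist_fork[of "u @ [c]" z k "[]"] u Suc.prems 0
          by (auto simp: tree_def)
      qed
      from sphere[OF Suc.prems subset_refl this] show ?thesis
        by (rule dbl) (use wy in auto)
    next
      case (Suc b')
      \<comment> \<open>Vertices in \<open>A\<close> leave \<open>z\<close> through another child
        than \<open>y\<close> does, so \<open>z\<close> is their meeting point with
        \<open>y\<close>.\<close>
      define A where "A = ?D b z - ?D b' (c # z)"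
      have sub: "?D b' (c # z) \<subseteq> ?D b z"
      proof
        fix x assume "x \<in> ?D b' (c # z)"
        then obtain v where "x = v @ c # z" "set v \<subseteq> {..<k}" "length v = b'"
          by (auto simp: descend_def)
        then show "x \<in> ?D b z"
          using Suc u(4) unfolding descend_def by (intro image_eqI[of _ _ "v @ [c]"]) auto
      qed
      have "tree_dist k y x = Suc a + b" if "x \<in> A" for x
      proof -
        have "x \<in> ?D b z"
          using that by (simp add: A_def)
        then obtain v where v: "x = v @ z" "set v \<subseteq> {..<k}" "length v = b"
          by (auto simp: descend_def)
        have "last v \<noteq> c"
        proof
          assume l: "last v = c"
          have "v \<noteq> []" using v Suc by auto
          then have "v = butlast v @ [c]" using l by auto
          then have "x = butlast v @ c # z" using v by (metis append.assoc append_Cons append_Nil)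
          moreover have "set (butlast v) \<subseteq> {..<k}" "length (butlast v) = b'"
            using v Suc by (auto dest: in_set_butlastD)
          ultimately have "x \<in> ?D b' (c # z)" unfolding descend_def by blast
          then show False using that A_def by blast
        qed
        then show ?thesis
          using tree_dist_fork[of "u @ [c]" z k v] u v Suc.prems by (auto simp: tree_def)
      qed
      from sphere[OF Suc.prems _ this, of A]
      have 1: "(\<Sum>x\<in>A. w x) \<le> C * real k powr (real b * p + real (Suc a) * \<delta>) * w y"
        by (auto simp: A_def)
      have "real k powr 1 \<le> real k powr (p + \<delta>)"
        using k p \<delta> by (intro powr_mono) auto
      then have "2 \<le> real k powr (p + \<delta>)"
        using k by simp
      then have "2 * (C * real k powr (real b' * p + real a * \<delta>) * w y)
          \<le> real k powr (p + \<delta>) * (C * real k powr (real b' * p + real a * \<delta>) * w y)"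
        using C wy by (intro mult_right_mono) auto
      also have "\<dots> = C * (real k powr (p + \<delta>) * real k powr (real b' * p + real a * \<delta>)) * w y"
        by simp
      also have "real k powr (p + \<delta>) * real k powr (real b' * p + real a * \<delta>)
          = real k powr (real b * p + real (Suc a) * \<delta>)"
        by (simp add: powr_add[symmetric] Suc algebra_simps)
      finally have 2: "2 * C * real k powr (real b' * p + real a * \<delta>) * w y
         \<le> C * real k powr (real b * p + real (Suc a) * \<delta>) * w y" by simp
      \<comment> \<open>Two pieces with constant \<open>C\<close> each give \<open>2 * C\<close>,
        which closes the induction.\<close>
      have "(\<Sum>x\<in>?D b z. w x) = (\<Sum>x\<in>A. w x) + (\<Sum>x\<in>?D b' (c # z). w x)"
        unfolding A_def using sub by (intro sum.subset_diff) auto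
      then show ?thesis
        using 1 2 Suc.IH[OF cz ycz, of b'] by linarith
    qed
  qed
  then show ?thesis
    unfolding tree_growth_def by blast
qed

section \<open>Fork averages\<close>

text \<open>Convexity: the graph lies above its tangent at \<open>t\<close>. Young's inequality for
  \<open>a\<close> and \<open>t powr (s - 1)\<close> with exponents \<open>s\<close> and
  \<open>s / (s - 1)\<close> is the same statement, rearranged.\<close>

lemma powr_above_tangent:
  fixes a t s :: real
  assumes "1 < s" "0 \<le> a" "0 < t"
  shows "t powr s + s * t powr (s - 1) * (a - t) \<le> a powr s"
proof -
  have "a * t powr (s - 1) \<le> a powr s / s + (t powr (s - 1)) powr (s / (s - 1)) / (s / (s - 1))"
    using assms by (intro Youngs_inequality) (auto simp: field_simps)
  also have "(t powr (s - 1)) powr (s / (s - 1)) = t powr s"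
    using assms by (simp add: powr_powr)
  finally have "s * (a * t powr (s - 1)) \<le> s * (a powr s / s + t powr s / (s / (s - 1)))"
    using assms by (intro mult_left_mono) auto
  also have "\<dots> = a powr s + (s - 1) * t powr s"
    using assms by (simp add: field_simps)
  finally have 1: "s * (a * t powr (s - 1)) \<le> a powr s + (s - 1) * t powr s" .
  have 2: "t * t powr (s - 1) = t powr s"
    using assms by (simp add: powr_mult_base)
  have "t powr s + s * t powr (s - 1) * (a - t)
      = t powr s + s * (a * t powr (s - 1)) - s * (t * t powr (s - 1))"
    by (simp add: algebra_simps)
  also have "\<dots> \<le> a powr s"
    using 1 unfolding 2 by (simp add: left_diff_distrib)
  finally show ?thesis .
qed

text \<open>Hoelder's inequality with weight \<open>u\<close>, in the form of Jensen's inequality: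
  the tangent bound for \<open>F / u\<close> is taken at its \<open>u\<close>-mean \<open>t\<close>
  and summed. The choice \<open>u = 1\<close> serves the bounds for \<open>w\<close>, the choice
  \<open>u = w\<close> the dual ones.\<close>

lemma sum_powr_le_weighted:
  fixes F u :: "'a \<Rightarrow> real"
  assumes s: "1 < s" and D: "finite D" and F: "\<And>y. y \<in> D \<Longrightarrow> 0 \<le> F y"
    and u: "\<And>y. y \<in> D \<Longrightarrow> 0 < u y"
  shows "(\<Sum>y\<in>D. F y) powr s \<le> (\<Sum>y\<in>D. F y powr s * u y powr (1 - s)) * (\<Sum>y\<in>D. u y) powr (s - 1)"
proof (cases "(\<Sum>y\<in>D. F y) = 0")
  case True
  then show ?thesis
    by (simp add: sum_nonneg)
next
  case False
  define N where "N = (\<Sum>y\<in>D. u y)"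
  define t where "t = (\<Sum>y\<in>D. F y) / N"
  have "D \<noteq> {}" using False by auto
  then have N: "N > 0" unfolding N_def using D u by (intro sum_pos) auto
  have Fpos: "(\<Sum>y\<in>D. F y) > 0"
    using False sum_nonneg[of D F] F by force
  then have t: "t > 0" using N by (simp add: t_def)
  have pt: "u y * t powr s + s * t powr (s - 1) * (F y - u y * t) \<le> F y powr s * u y powr (1 - s)"
    if y: "y \<in> D" for y
  proof -
    have "u y * (t powr s + s * t powr (s - 1) * (F y / u y - t)) \<le> u y * (F y / u y) powr s"
      using powr_above_tangent[OF s _ t, of "F y / u y"] F[OF y] u[OF y]
      by (intro mult_left_mono) auto
    also have "u y * (F y / u y) powr s = F y powr s * u y powr (1 - s)"
      using F[OF y] u[OF y] by (simp add: powr_divide powr_diff)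
    also have "u y * (t powr s + s * t powr (s - 1) * (F y / u y - t))
        = u y * t powr s + s * t powr (s - 1) * (F y - u y * t)"
      using u[OF y] by (simp add: field_simps)
    finally show ?thesis .
  qed
  have "(\<Sum>y\<in>D. F y) powr s = t powr s * N powr s"
    using N Fpos by (simp add: t_def powr_divide)
  also have "\<dots> = (N * t powr s) * N powr (s - 1)"
    using N by (simp add: powr_diff)
  also have "N * t powr s = (\<Sum>y\<in>D. u y * t powr s + s * t powr (s - 1) * (F y - u y * t))"
  proof -
    \<comment> \<open>\<open>t\<close> is the \<open>u\<close>-mean of \<open>F / u\<close>, so the
      linear terms cancel.\<close>
    have "(\<Sum>y\<in>D. F y - u y * t) = 0"
      using N unfolding sum_subtractf sum_distrib_right[symmetric] N_def[symmetric] by (simp add: t_def)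
    then show ?thesis
      by (simp add: sum.distrib sum_distrib_left[symmetric] sum_distrib_right[symmetric] N_def)
  qed
  also have "\<dots> * N powr (s - 1) \<le> (\<Sum>y\<in>D. F y powr s * u y powr (1 - s)) * N powr (s - 1)"
    by (intro mult_right_mono sum_mono pt) auto
  finally show ?thesis by (simp add: N_def)
qed

section \<open>Reduction of ball averages to fork averages\<close>

lemma sum_UN_le:
  fixes g :: "'a \<Rightarrow> real"
  assumes "finite I" "\<And>i. i \<in> I \<Longrightarrow> finite (A i)" "\<And>x. 0 \<le> g x"
  shows "(\<Sum>x\<in>(\<Union>i\<in>I. A i). g x) \<le> (\<Sum>i\<in>I. \<Sum>x\<in>A i. g x)"
  using assms(1,2)
proof (induction I rule: finite_induct)
  case (insert i I)
  have "(\<Sum>x\<in>A i \<union> (\<Union>i\<in>I. A i). g x) \<le> (\<Sum>x\<in>A i. g x) + (\<Sum>x\<in>(\<Union>i\<in>I. A i). g x)"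
    using insert by (subst sum_Un) (auto simp: sum_nonneg assms(3))
  then show ?case
    using insert by force
qed simp

text \<open>The divisor is the lower bound for the size of a ball of radius \<open>a + b\<close>,
  not the number \<open>k ^ a\<close> of summands. The value 0 for large \<open>b\<close> prevents
  \<open>drop\<close> from returning the root again and again.\<close>

definition fork_avg :: "nat \<Rightarrow> nat \<Rightarrow> nat \<Rightarrow> (nat list \<Rightarrow> real) \<Rightarrow> nat list \<Rightarrow> real" where
  "fork_avg k a b F x =
     (if b \<le> length x then (\<Sum>y\<in>descend k a (drop b x). F y) / real k ^ (a + b) else 0)"

lemma fork_avg_nonneg: "(\<And>y. 0 \<le> F y) \<Longrightarrow> 0 \<le> fork_avg k a b F x"
  by (auto simp: fork_avg_def intro!: sum_nonneg divide_nonneg_nonneg)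

text \<open>The ball is covered by generations below the ancestors of \<open>x\<close>. Dividing by
  \<open>k ^ r\<close> in place of \<open>k ^ (a + b)\<close> leaves
  \<open>1 / k ^ (r - a - b)\<close>.\<close>

lemma ball_avg_le_fork_avg:
  assumes k: "2 \<le> k" and F: "\<And>y. 0 \<le> F y" and x: "x \<in> tree k"
  shows "(\<Sum>y\<in>tree_ball k x r. F y) / real (card (tree_ball k x r))
     \<le> (\<Sum>a\<le>r. \<Sum>b\<le>r - a. fork_avg k a b F x / real k ^ (r - a - b))"
proof -
  define P where "P = {(a, b). a + b \<le> r \<and> b \<le> length x}"
  define Q where "Q = (SIGMA a:{..r}. {..r - a})"
  have PQ: "P \<subseteq> Q" and finQ: "finite Q"
    by (auto simp: P_def Q_def)
  then have finP: "finite P"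
    using finite_subset by blast
  have "(\<Sum>y\<in>tree_ball k x r. F y) \<le> (\<Sum>y\<in>(\<Union>(a, b)\<in>P. descend k a (drop b x)). F y)"
    using tree_ball_cover[OF x, of r] finP F unfolding P_def[symmetric]
    by (intro sum_mono2) auto
  also have "\<dots> \<le> (\<Sum>i\<in>P. \<Sum>y\<in>(case i of (a, b) \<Rightarrow> descend k a (drop b x)). F y)"
    using finP F by (intro sum_UN_le) auto
  also have "\<dots> = (\<Sum>(a, b)\<in>P. fork_avg k a b F x * real k ^ (a + b))"
    using k by (intro sum.cong) (auto simp: fork_avg_def P_def)
  \<comment> \<open>This frees the index set from \<open>x\<close>; the added terms have
    \<open>b > length x\<close> and vanish.\<close>
  also have "\<dots> \<le> (\<Sum>(a, b)\<in>Q. fork_avg k a b F x * real k ^ (a + b))"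
    using PQ finQ F by (intro sum_mono2) (auto intro!: mult_nonneg_nonneg fork_avg_nonneg)
  finally have "(\<Sum>y\<in>tree_ball k x r. F y) / real k ^ r
     \<le> (\<Sum>(a, b)\<in>Q. fork_avg k a b F x * real k ^ (a + b)) / real k ^ r"
    by (intro divide_right_mono) auto
  also have "\<dots> = (\<Sum>(a, b)\<in>Q. fork_avg k a b F x / real k ^ (r - a - b))"
  proof -
    have "t * real k ^ (a + b) / real k ^ r = t / real k ^ (r - a - b)"
      if "a \<le> r" "b \<le> r - a" for a b t
    proof -
      have "r = (a + b) + (r - a - b)" using that by simp
      then have "real k ^ r = real k ^ (a + b) * real k ^ (r - a - b)"
        by (metis power_add)
      then show ?thesis using k by simp
    qed
    then show ?thesis
      unfolding sum_divide_distrib by (intro sum.cong) (auto simp: Q_def)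
  qed
  also have "\<dots> = (\<Sum>a\<le>r. \<Sum>b\<le>r - a. fork_avg k a b F x / real k ^ (r - a - b))"
    unfolding Q_def by (subst sum.Sigma) auto
  finally have 1: "(\<Sum>y\<in>tree_ball k x r. F y) / real k ^ r
      \<le> (\<Sum>a\<le>r. \<Sum>b\<le>r - a. fork_avg k a b F x / real k ^ (r - a - b))" .
  have "real k ^ r \<le> real (card (tree_ball k x r))"
    using card_ball_ge[OF x, of r] by (metis of_nat_le_iff of_nat_power)
  moreover from this have "0 < real (card (tree_ball k x r))"
    by (rule less_le_trans[rotated]) (use k in simp)
  ultimately have "(\<Sum>y\<in>tree_ball k x r. F y) / real (card (tree_ball k x r))
      \<le> (\<Sum>y\<in>tree_ball k x r. F y) / real k ^ r"
    using F k by (intro divide_left_mono mult_pos_pos sum_nonneg) auto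
  with 1 show ?thesis by linarith
qed

lemma sum_geometric_le:
  fixes \<rho> :: real
  assumes "0 \<le> \<rho>" "\<rho> < 1"
  shows "(\<Sum>i\<le>n. \<rho> ^ i) \<le> 1 / (1 - \<rho>)"
  using sum_le_suminf[OF summable_geometric, of \<rho> "{..n}"] suminf_geometric[of \<rho>] assms
  by auto

text \<open>A weight is needed in \<open>a\<close> only: dividing by \<open>|B(x,r)| \<ge> k^r\<close> instead of \<open>k^(a+b)\<close> leaves the
  factor \<open>k^(-(r-a-b))\<close>, whose sum over \<open>b\<close> is bounded.\<close>

lemma ball_avg_le_single_fork_avg:
  assumes k: "2 \<le> k" and \<eta>: "0 < \<eta>"
  shows "\<exists>S>0. \<forall>F. \<forall>x\<in>tree k. \<forall>r. (\<forall>y. 0 \<le> F y) \<longrightarrow>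
       (\<exists>a b. (\<Sum>y\<in>tree_ball k x r. F y) / real (card (tree_ball k x r))
          \<le> S * real k powr (\<eta> * real a) * fork_avg k a b F x)"
proof -
  define \<rho> where "\<rho> = real k powr (- \<eta>)"
  have "real k powr (- \<eta>) < real k powr 0"
    using k \<eta> by (intro powr_less_mono) auto
  then have \<rho>: "0 < \<rho>" "\<rho> < 1"
    using k by (auto simp: \<rho>_def)
  \<comment> \<open>The sum over \<open>b\<close> costs a factor 2 and the sum over \<open>a\<close>
    a factor \<open>1 / (1 - \<rho>)\<close>; the other factor 2 makes the final bound
    \<open>B / 2\<close>.\<close>
  define S where "S = 4 / (1 - \<rho>)"
  have S: "S > 0" using \<rho> by (simp add: S_def)
  have "\<exists>a b. (\<Sum>y\<in>tree_ball k x r. F y) / real (card (tree_ball k x r))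
          \<le> S * real k powr (\<eta> * real a) * fork_avg k a b F x"
    if F: "\<And>y. 0 \<le> F y" and x: "x \<in> tree k" for F :: "nat list \<Rightarrow> real" and x r
  proof (rule ccontr)
    define B where "B = (\<Sum>y\<in>tree_ball k x r. F y) / real (card (tree_ball k x r))"
    assume "\<not> ?thesis"
    then have less: "S * real k powr (\<eta> * real a) * fork_avg k a b F x < B" for a b
      unfolding B_def by (meson not_le)
    \<comment> \<open>The pair \<open>(0, 0)\<close> forces \<open>B > 0\<close>, so that
      \<open>B \<le> B / 2\<close> is absurd.\<close>
    have "0 \<le> S * real k powr (\<eta> * real 0) * fork_avg k 0 0 F x"
      using S F by (intro mult_nonneg_nonneg fork_avg_nonneg) auto
    then have B: "0 < B" using less[of 0 0] by linarith
    have le: "fork_avg k a b F x \<le> B / S * \<rho> ^ a" for a b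
    proof -
      have "real k powr (\<eta> * real a) * \<rho> ^ a = 1"
        using k by (simp add: \<rho>_def powr_realpow[symmetric] powr_powr powr_add[symmetric])
      then have "S * fork_avg k a b F x = (S * real k powr (\<eta> * real a) * fork_avg k a b F x) * \<rho> ^ a"
        by simp
      also have "\<dots> \<le> B * \<rho> ^ a"
        using less[of a b] \<rho> by (intro mult_right_mono) auto
      finally show ?thesis using S by (simp add: field_simps)
    qed
    have inner: "(\<Sum>b\<le>n. 1 / real k ^ (n - b)) \<le> 2" for n
    proof -
      have "(\<Sum>b\<le>n. 1 / real k ^ (n - b)) = (\<Sum>b\<le>n. 1 / real k ^ b)"
        by (rule sum.reindex_bij_witness[of _ "\<lambda>b. n - b" "\<lambda>b. n - b"]) auto
      also have "\<dots> \<le> (\<Sum>b\<le>n. (1 / 2) ^ b)"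
        using k by (intro sum_mono) (auto simp: power_divide intro!: divide_left_mono power_mono)
      also have "\<dots> \<le> 2"
        using sum_geometric_le[of "1 / 2" n] by simp
      finally show ?thesis .
    qed
    have "B \<le> (\<Sum>a\<le>r. \<Sum>b\<le>r - a. fork_avg k a b F x / real k ^ (r - a - b))"
      unfolding B_def by (rule ball_avg_le_fork_avg[OF k F x])
    also have "\<dots> \<le> (\<Sum>a\<le>r. \<Sum>b\<le>r - a. (B / S * \<rho> ^ a) * (1 / real k ^ (r - a - b)))"
      using divide_right_mono[OF le] by (intro sum_mono) simp
    also have "\<dots> = (\<Sum>a\<le>r. (B / S * \<rho> ^ a) * (\<Sum>b\<le>r - a. 1 / real k ^ (r - a - b)))"
      by (simp only: sum_distrib_left)
    also have "\<dots> \<le> (\<Sum>a\<le>r. (B / S * \<rho> ^ a) * 2)"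
      using B S \<rho> by (intro sum_mono mult_left_mono inner) auto
    also have "\<dots> = 2 * (B / S) * (\<Sum>a\<le>r. \<rho> ^ a)"
      by (simp add: sum_distrib_left sum_divide_distrib mult_ac)
    also have "\<dots> \<le> 2 * (B / S) * (1 / (1 - \<rho>))"
      using B S \<rho> by (intro mult_left_mono sum_geometric_le) auto
    also have "\<dots> = B / 2"
      using \<rho> by (simp add: S_def field_simps)
    finally show False using B by simp
  qed
  with S show ?thesis by blast
qed

section \<open>Strong type bounds\<close>

lemma ennpowr_ennreal: "0 \<le> x \<Longrightarrow> ennpowr (ennreal x) q = ennreal (x powr q)"
  by (simp add: ennpowr_def)

lemma ennpowr_mono:
  assumes "0 \<le> q" "a \<le> b"
  shows "ennpowr a q \<le> ennpowr b q"
proof (cases "b = \<infinity>")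
  case False
  then obtain x y where "a = ennreal x" "b = ennreal y" "0 \<le> x" "0 \<le> y"
    using assms(2) by (cases a; cases b) (auto simp: top_unique)
  then show ?thesis
    using assms by (auto simp: ennpowr_ennreal intro!: powr_mono2)
qed (simp add: ennpowr_def)

lemma ennpowr_mult_ennreal:
  assumes "0 < c"
  shows "ennpowr (ennreal c * a) q = ennreal (c powr q) * ennpowr a q"
proof (cases a)
  case (real x)
  then show ?thesis
    using assms by (simp add: ennreal_mult[symmetric] ennpowr_ennreal powr_mult)
next
  case top
  then show ?thesis
    using assms by (simp add: ennpowr_def ennreal_mult_top)
qed

text \<open>Tonelli for the relation between \<open>x\<close> and its \<open>b\<close>-th ancestor
  \<open>z\<close>, which is unique if \<open>b \<le> length x\<close> and absent otherwise.\<close>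

lemma regroup_by_ancestor:
  fixes h :: "nat list \<Rightarrow> nat list \<Rightarrow> ennreal"
  shows "(\<integral>\<^sup>+x. (if b \<le> length x then h x (drop b x) else 0) \<partial>count_space (tree k))
     = (\<integral>\<^sup>+z. (\<Sum>x\<in>descend k b z. h x z) \<partial>count_space (tree k))"
proof -
  define g where "g x z = (if x \<in> descend k b z then h x z else 0)" for x z
  have 1: "(if b \<le> length x then h x (drop b x) else 0) = (\<integral>\<^sup>+z. g x z \<partial>count_space (tree k))"
    if x: "x \<in> tree k" for x
  proof (cases "b \<le> length x")
    case True
    have "(\<integral>\<^sup>+z. g x z \<partial>count_space (tree k)) = (\<Sum>z\<in>{drop b x}. g x z)"
      using x True drop_in_tree[OF x, of b]
      by (intro nn_integral_count_space') (auto simp: g_def descend_tree_iff)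
    then show ?thesis
      using x True drop_in_tree[OF x, of b] by (simp add: g_def descend_tree_iff)
  next
    case False
    have "(\<integral>\<^sup>+z. g x z \<partial>count_space (tree k)) = (\<integral>\<^sup>+z. 0 \<partial>count_space (tree k))"
      using x False by (intro nn_integral_cong) (auto simp: g_def descend_tree_iff)
    then show ?thesis using False by simp
  qed
  have 2: "(\<Sum>x\<in>descend k b z. h x z) = (\<integral>\<^sup>+x. g x z \<partial>count_space (tree k))"
    if z: "z \<in> tree k" for z
  proof -
    have "(\<integral>\<^sup>+x. g x z \<partial>count_space (tree k)) = (\<Sum>x\<in>descend k b z. g x z)"
      using descend_subset_tree[OF z] by (intro nn_integral_count_space') (auto simp: g_def)
    then show ?thesis by (simp add: g_def)
  qed
  have "(\<integral>\<^sup>+x. (if b \<le> length x then h x (drop b x) else 0) \<partial>count_space (tree k))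
    = (\<integral>\<^sup>+x. (\<integral>\<^sup>+z. g x z \<partial>count_space (tree k)) \<partial>count_space (tree k))"
    by (intro nn_integral_cong 1) simp
  also have "\<dots> = (\<integral>\<^sup>+z. (\<integral>\<^sup>+x. g x z \<partial>count_space (tree k)) \<partial>count_space (tree k))"
    by (intro nn_integral_count_space_nn_integral countable_tree) simp
  also have "\<dots> = (\<integral>\<^sup>+z. (\<Sum>x\<in>descend k b z. h x z) \<partial>count_space (tree k))"
    by (intro nn_integral_cong 2[symmetric]) simp
  finally show ?thesis .
qed

text \<open>Each \<open>y\<close> is counted for its \<open>a\<close>-th ancestor only, hence at
  most once.\<close>

lemma nn_integral_sum_descend_le:
  fixes H :: "nat list \<Rightarrow> ennreal"
  shows "(\<integral>\<^sup>+z. (\<Sum>y\<in>descend k a z. H y) \<partial>count_space (tree k))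
     \<le> (\<integral>\<^sup>+y. H y \<partial>count_space (tree k))"
  unfolding regroup_by_ancestor[symmetric] by (intro nn_integral_mono) auto

lemma le_double_suminf:
  fixes X :: "nat \<Rightarrow> nat \<Rightarrow> ennreal"
  shows "X a b \<le> (\<Sum>a. \<Sum>b. X a b)"
proof -
  have "X a b \<le> (\<Sum>b. X a b)"
    using sum_le_suminf[of "X a" "{b}"] by simp
  also have "\<dots> \<le> (\<Sum>a. \<Sum>b. X a b)"
    using sum_le_suminf[of "\<lambda>a. \<Sum>b. X a b" "{a}"] by simp
  finally show ?thesis .
qed

lemma suminf_powr_geometric:
  assumes k: "2 \<le> k" and \<eta>: "0 < (\<eta>::real)"
  shows "\<exists>G>0. (\<Sum>a. ennreal (real k powr (- \<eta> * real a))) = ennreal G"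
proof -
  define \<rho> where "\<rho> = real k powr (- \<eta>)"
  have "real k powr (- \<eta>) < real k powr 0"
    using k \<eta> by (intro powr_less_mono) auto
  then have \<rho>: "0 < \<rho>" "\<rho> < 1"
    using k by (auto simp: \<rho>_def)
  have "real k powr (- \<eta> * real a) = \<rho> ^ a" for a
    using k by (simp add: \<rho>_def powr_realpow[symmetric] powr_powr)
  then have "(\<Sum>a. ennreal (real k powr (- \<eta> * real a))) = ennreal (1 / (1 - \<rho>))"
    using \<rho> by (simp only:) (intro suminf_ennreal_eq geometric_sums, auto)
  moreover have "0 < 1 / (1 - \<rho>)" using \<rho> by simp
  ultimately show ?thesis by blast
qed

lemma Lq_norm_leI:
  assumes "0 < q" "0 < K"
    and "(\<integral>\<^sup>+x. ennpowr (g x) q * ennreal (v x) \<partial>count_space (tree k))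
       \<le> ennreal K * (\<integral>\<^sup>+x. ennpowr (h x) q * ennreal (v x) \<partial>count_space (tree k))"
  shows "Lq_norm k q v g \<le> ennreal (K powr (1 / q)) * Lq_norm k q v h"
  unfolding Lq_norm_def ennpowr_mult_ennreal[OF assms(2), symmetric]
  using assms by (intro ennpowr_mono) auto

text \<open>Grouping \<open>x\<close> by its \<open>b\<close>-th ancestor turns \<open>est\<close>
  into a bound for one fork average, with decay in \<open>a\<close> and in \<open>b\<close>. A ball
  average is controlled by a single pair \<open>(a, b)\<close>, so its \<open>s\<close>-th power is
  at most the sum of the \<open>s\<close>-th powers over all pairs, and no triangle inequality
  enters.\<close>

lemma strong_type:
  fixes v :: "nat list \<Rightarrow> real" and \<alpha> \<beta> s K :: real
  assumes k: "2 \<le> k" and s: "0 < s" and v: "is_weight k v" and K: "0 < K" and \<alpha>: "0 < \<alpha>" and \<beta>: "0 < \<beta>"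
    and est: "\<And>a b z F. z \<in> tree k \<Longrightarrow> (\<And>y. 0 \<le> F y) \<Longrightarrow>
      (\<Sum>x\<in>descend k b z. v x * (\<Sum>y\<in>descend k a z. F y) powr s)
       \<le> K * real k powr ((real a + real b) * s - \<alpha> * real a - \<beta> * real b)
           * (\<Sum>y\<in>descend k a z. F y powr s * v y)"
  shows "\<exists>C::real. \<forall>f :: nat list \<Rightarrow> complex.
     Lq_norm k s v (maximal_fun k f) \<le> ennreal C * Lq_norm k s v (\<lambda>x. ennreal (norm (f x)))"
proof -
  let ?T = "count_space (tree k)"
  \<comment> \<open>The pointwise factor \<open>k powr (\<eta> * a)\<close>, raised to the power
    \<open>s\<close>, uses up half of the decay \<open>\<alpha>\<close>.\<close>
  define \<eta> where "\<eta> = \<alpha> / (2 * s)"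
  have \<eta>: "0 < \<eta>" using \<alpha> s by (simp add: \<eta>_def)
  obtain S where S: "S > 0" and pw: "\<forall>F. \<forall>x\<in>tree k. \<forall>r. (\<forall>y. 0 \<le> F y) \<longrightarrow>
       (\<exists>a b. (\<Sum>y\<in>tree_ball k x r. F y) / real (card (tree_ball k x r))
          \<le> S * real k powr (\<eta> * real a) * fork_avg k a b F x)"
    using ball_avg_le_single_fork_avg[OF k \<eta>] by (elim exE conjE) (rule that)
  obtain G1 where G1: "0 < G1" "(\<Sum>a. ennreal (real k powr (- (\<alpha> / 2) * real a))) = ennreal G1"
    using suminf_powr_geometric[OF k half_gt_zero[OF \<alpha>]] by blast
  obtain G2 where G2: "0 < G2" "(\<Sum>b. ennreal (real k powr (- \<beta> * real b))) = ennreal G2"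
    using suminf_powr_geometric[OF k \<beta>] by blast
  have v0: "0 \<le> v x" if "x \<in> tree k" for x
    using v that by (simp add: is_weight_def less_imp_le)
  have main: "(\<integral>\<^sup>+x. ennpowr (maximal_fun k f x) s * ennreal (v x) \<partial>?T)
     \<le> ennreal (S powr s * K * G1 * G2)
        * (\<integral>\<^sup>+x. ennpowr (ennreal (norm (f x))) s * ennreal (v x) \<partial>?T)" for f :: "nat list \<Rightarrow> complex"
  proof -
    define F where "F x = norm (f x)" for x
    have F: "0 \<le> F x" for x by (simp add: F_def)
    define I where "I = (\<integral>\<^sup>+x. ennreal (F x powr s * v x) \<partial>?T)"
    have I: "(\<integral>\<^sup>+x. ennpowr (ennreal (norm (f x))) s * ennreal (v x) \<partial>?T) = I"
      unfolding I_def by (intro nn_integral_cong) (simp add: F_def ennpowr_ennreal ennreal_mult' )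
    have J: "(\<integral>\<^sup>+x. ennreal (fork_avg k a b F x powr s * v x) \<partial>?T)
        \<le> ennreal (K * real k powr (- \<alpha> * real a - \<beta> * real b)) * I" for a b
    proof -
      have "(\<integral>\<^sup>+x. ennreal (fork_avg k a b F x powr s * v x) \<partial>?T) =
         (\<integral>\<^sup>+x. (if b \<le> length x then ennreal (((\<Sum>y\<in>descend k a (drop b x). F y) / real k ^ (a + b)) powr s * v x) else 0) \<partial>?T)"
        using s by (intro nn_integral_cong) (auto simp: fork_avg_def)
      also have "\<dots> = (\<integral>\<^sup>+z. (\<Sum>x\<in>descend k b z. ennreal (((\<Sum>y\<in>descend k a z. F y) / real k ^ (a + b)) powr s * v x)) \<partial>?T)"
        by (rule regroup_by_ancestor[where h = "\<lambda>x z. ennreal (((\<Sum>y\<in>descend k a z. F y) / real k ^ (a + b)) powr s * v x)"])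
      also have "\<dots> \<le> (\<integral>\<^sup>+z. ennreal (K * real k powr (- \<alpha> * real a - \<beta> * real b))
           * (\<Sum>y\<in>descend k a z. ennreal (F y powr s * v y)) \<partial>?T)"
      proof (intro nn_integral_mono)
        fix z assume "z \<in> space ?T"
        then have z: "z \<in> tree k" by simp
        have kp: "real k ^ (a + b) = real k powr (real a + real b)"
          using k by (simp add: powr_realpow[symmetric])
        have "(\<Sum>x\<in>descend k b z. ((\<Sum>y\<in>descend k a z. F y) / real k ^ (a + b)) powr s * v x)
            = (\<Sum>x\<in>descend k b z. v x * (\<Sum>y\<in>descend k a z. F y) powr s) / real k powr ((real a + real b) * s)"
        proof -
          have "((\<Sum>y\<in>descend k a z. F y) / real k ^ (a + b)) powr s
              = (\<Sum>y\<in>descend k a z. F y) powr s / real k powr ((real a + real b) * s)"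
            unfolding kp using F by (simp only: powr_divide sum_nonneg powr_powr powr_ge_zero)
          then show ?thesis
            by (simp only: sum_divide_distrib mult.commute[of "v _"] times_divide_eq_left)
        qed
        also have "\<dots> \<le> (K * real k powr ((real a + real b) * s - \<alpha> * real a - \<beta> * real b)
           * (\<Sum>y\<in>descend k a z. F y powr s * v y)) / real k powr ((real a + real b) * s)"
          by (intro divide_right_mono est[OF z F]) auto
        also have "\<dots> = K * (real k powr ((real a + real b) * s - \<alpha> * real a - \<beta> * real b) / real k powr ((real a + real b) * s))
           * (\<Sum>y\<in>descend k a z. F y powr s * v y)"
          by (simp only: times_divide_eq_left times_divide_eq_right)
        also have "real k powr ((real a + real b) * s - \<alpha> * real a - \<beta> * real b) / real k powr ((real a + real b) * s)
           = real k powr (- \<alpha> * real a - \<beta> * real b)"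
          by (subst powr_diff[symmetric]) simp
        finally have le: "(\<Sum>x\<in>descend k b z. ((\<Sum>y\<in>descend k a z. F y) / real k ^ (a + b)) powr s * v x)
          \<le> K * real k powr (- \<alpha> * real a - \<beta> * real b) * (\<Sum>y\<in>descend k a z. F y powr s * v y)" .
        have nn: "\<And>x c. x \<in> descend k c z \<Longrightarrow> 0 \<le> v x"
          using v0 descend_subset_tree[OF z] by blast
        have "(\<Sum>x\<in>descend k b z. ennreal (((\<Sum>y\<in>descend k a z. F y) / real k ^ (a + b)) powr s * v x))
          = ennreal (\<Sum>x\<in>descend k b z. ((\<Sum>y\<in>descend k a z. F y) / real k ^ (a + b)) powr s * v x)"
          using nn by (intro sum_ennreal) auto
        also have "\<dots> \<le> ennreal (K * real k powr (- \<alpha> * real a - \<beta> * real b) * (\<Sum>y\<in>descend k a z. F y powr s * v y))"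
          using le by (rule ennreal_leI)
        also have "\<dots> = ennreal (K * real k powr (- \<alpha> * real a - \<beta> * real b)) * ennreal (\<Sum>y\<in>descend k a z. F y powr s * v y)"
          using K by (intro ennreal_mult') auto
        also have "ennreal (\<Sum>y\<in>descend k a z. F y powr s * v y) = (\<Sum>y\<in>descend k a z. ennreal (F y powr s * v y))"
          using nn by (intro sum_ennreal[symmetric]) auto
        finally show "(\<Sum>x\<in>descend k b z. ennreal (((\<Sum>y\<in>descend k a z. F y) / real k ^ (a + b)) powr s * v x))
          \<le> ennreal (K * real k powr (- \<alpha> * real a - \<beta> * real b)) * (\<Sum>y\<in>descend k a z. ennreal (F y powr s * v y))" .
      qed
      also have "\<dots> = ennreal (K * real k powr (- \<alpha> * real a - \<beta> * real b))
         * (\<integral>\<^sup>+z. (\<Sum>y\<in>descend k a z. ennreal (F y powr s * v y)) \<partial>?T)"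
        by (intro nn_integral_cmult) auto
      also have "\<dots> \<le> ennreal (K * real k powr (- \<alpha> * real a - \<beta> * real b)) * I"
        unfolding I_def by (intro mult_left_mono nn_integral_sum_descend_le) auto
      finally show ?thesis .
    qed
    \<comment> \<open>The contribution of one pair. Summing over all pairs dispenses with knowing
      which pair is the right one for given \<open>x\<close> and \<open>r\<close>.\<close>
    define X where "X a b x = ennreal ((S * real k powr (\<eta> * real a)) powr s)
        * ennreal (fork_avg k a b F x powr s * v x)" for a b x
    have pt: "ennpowr (maximal_fun k f x) s * ennreal (v x) \<le> (\<Sum>a. \<Sum>b. X a b x)"
      if x: "x \<in> tree k" for x
    proof (cases "(\<Sum>a. \<Sum>b. X a b x) = top")
      case False
      have vx: "0 < v x" using v x by (simp add: is_weight_def)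
      obtain R where R: "0 \<le> R" "(\<Sum>a. \<Sum>b. X a b x) = ennreal R"
        using False by (cases "\<Sum>a. \<Sum>b. X a b x") auto
      \<comment> \<open>\<open>R\<close> does not depend on the radius, so
        \<open>B powr s * v x \<le> R\<close> for each ball average passes to the supremum once
        roots are taken.\<close>
      have "maximal_fun k f x \<le> ennreal ((R / v x) powr (1 / s))"
        unfolding maximal_fun_def
      proof (intro SUP_least ennreal_leI)
        fix r
        define B where "B = (\<Sum>y\<in>tree_ball k x r. norm (f y)) / real (card (tree_ball k x r))"
        have B0: "0 \<le> B" unfolding B_def by (intro divide_nonneg_nonneg sum_nonneg) auto
        have "\<exists>a b. B \<le> S * real k powr (\<eta> * real a) * fork_avg k a b F x"
          using pw[rule_format, of x F r, OF x F] by (simp only: B_def F_def[abs_def])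
        then obtain a b where ab: "B \<le> S * real k powr (\<eta> * real a) * fork_avg k a b F x"
          by blast
        have "ennreal (B powr s * v x) \<le> ennreal ((S * real k powr (\<eta> * real a) * fork_avg k a b F x) powr s * v x)"
          using ab B0 s vx by (intro ennreal_leI mult_right_mono powr_mono2) auto
        also have "\<dots> = X a b x"
          using S fork_avg_nonneg[of F k a b x] F vx
          by (simp add: X_def powr_mult ennreal_mult[symmetric] mult_ac)
        also have "\<dots> \<le> ennreal R"
          unfolding R(2)[symmetric] by (rule le_double_suminf)
        finally have "B powr s * v x \<le> R"
          using R by simp
        then have "B powr s \<le> R / v x"
          using vx by (simp add: field_simps)
        then have "(B powr s) powr (1 / s) \<le> (R / v x) powr (1 / s)"
          using s by (intro powr_mono2) auto
        then show "B \<le> (R / v x) powr (1 / s)"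
          using s B0 by (simp add: powr_powr)
      qed
      then have "ennpowr (maximal_fun k f x) s \<le> ennpowr (ennreal ((R / v x) powr (1 / s))) s"
        using s by (intro ennpowr_mono) auto
      also have "\<dots> = ennreal (R / v x)"
        using s R vx by (simp add: ennpowr_ennreal powr_powr)
      finally have "ennpowr (maximal_fun k f x) s * ennreal (v x) \<le> ennreal (R / v x) * ennreal (v x)"
        by (intro mult_right_mono) auto
      also have "\<dots> = ennreal R"
        using R vx by (simp add: ennreal_mult[symmetric])
      finally show ?thesis unfolding R(2) .
    qed simp
    have "(\<integral>\<^sup>+x. ennpowr (maximal_fun k f x) s * ennreal (v x) \<partial>?T) \<le> (\<integral>\<^sup>+x. (\<Sum>a. \<Sum>b. X a b x) \<partial>?T)"
      by (intro nn_integral_mono pt) simp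
    also have "\<dots> = (\<Sum>a. \<Sum>b. \<integral>\<^sup>+x. X a b x \<partial>?T)"
      by (simp add: nn_integral_suminf)
    also have "\<dots> \<le> (\<Sum>a. \<Sum>b. ennreal (S powr s * K) * I
        * ennreal (real k powr (- (\<alpha> / 2) * real a)) * ennreal (real k powr (- \<beta> * real b)))"
    proof (intro suminf_le summableI)
      fix a b
      have "(\<integral>\<^sup>+x. X a b x \<partial>?T) \<le> ennreal ((S * real k powr (\<eta> * real a)) powr s)
         * (ennreal (K * real k powr (- \<alpha> * real a - \<beta> * real b)) * I)"
        unfolding X_def by (subst nn_integral_cmult) (auto intro!: mult_left_mono J[simplified])
      also have "\<dots> = ennreal ((S * real k powr (\<eta> * real a)) powr s * (K * real k powr (- \<alpha> * real a - \<beta> * real b))) * I"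
        using K by (simp add: ennreal_mult mult.assoc)
      also have "(S * real k powr (\<eta> * real a)) powr s * (K * real k powr (- \<alpha> * real a - \<beta> * real b))
        = (S powr s * K) * (real k powr (- (\<alpha> / 2) * real a) * real k powr (- \<beta> * real b))"
      proof -
        have "(S * real k powr (\<eta> * real a)) powr s = S powr s * real k powr (\<alpha> / 2 * real a)"
          using S s by (simp add: powr_mult powr_powr \<eta>_def)
        moreover have "real k powr (\<alpha> / 2 * real a) * real k powr (- \<alpha> * real a - \<beta> * real b)
          = real k powr (- (\<alpha> / 2) * real a) * real k powr (- \<beta> * real b)"
        proof -
          have "\<alpha> / 2 * real a + (- \<alpha> * real a - \<beta> * real b) = - (\<alpha> / 2) * real a + - \<beta> * real b"
            by (simp add: algebra_simps)
          then show ?thesis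
            by (simp only: powr_add[symmetric])
        qed
        ultimately show ?thesis by simp
      qed
      also have "ennreal ((S powr s * K) * (real k powr (- (\<alpha> / 2) * real a) * real k powr (- \<beta> * real b))) * I
        = ennreal (S powr s * K) * I
        * ennreal (real k powr (- (\<alpha> / 2) * real a)) * ennreal (real k powr (- \<beta> * real b))"
        using K by (simp add: ennreal_mult mult_ac)
      finally show "(\<integral>\<^sup>+x. X a b x \<partial>?T) \<le> ennreal (S powr s * K) * I
        * ennreal (real k powr (- (\<alpha> / 2) * real a)) * ennreal (real k powr (- \<beta> * real b))" .
    qed
    also have "\<dots> = ennreal (S powr s * K) * I * ennreal G1 * ennreal G2"
      by (simp only: ennreal_suminf_cmult ennreal_suminf_multc G1(2) G2(2))
    also have "\<dots> = ennreal (S powr s * K * G1 * G2) * I"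
      using K G1 G2 by (simp add: ennreal_mult mult_ac)
    finally show ?thesis unfolding I .
  qed
  have "0 < S powr s * K * G1 * G2"
    using S K G1 G2 by simp
  from Lq_norm_leI[OF s this main] show ?thesis by blast
qed

section \<open>The weak type endpoint\<close>

text \<open>A geometric sum with ratio at least 2 is at most twice its last term, and the last term
  kept is below \<open>X\<close>.\<close>

lemma sum_power_below_le:
  fixes c X :: real
  assumes "2 \<le> c" "0 \<le> X"
  shows "(\<Sum>b<n. if c ^ b < X then c ^ b else 0) \<le> 2 * X"
proof -
  have geo: "(\<Sum>b<Suc m. c ^ b) \<le> 2 * c ^ m" for m
  proof (induction m)
    case (Suc m)
    have "2 * c ^ m \<le> c * c ^ m"
      using assms by (intro mult_right_mono) auto
    then show ?case using Suc by simp
  qed simp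
  show ?thesis
  proof (induction n)
    case (Suc n)
    show ?case
    proof (cases "c ^ n < X")
      case True
      have "(\<Sum>b<Suc n. if c ^ b < X then c ^ b else 0) \<le> (\<Sum>b<Suc n. c ^ b)"
        using assms by (intro sum_mono) auto
      then show ?thesis using geo[of n] True by linarith
    next
      case False
      then show ?thesis using Suc by simp
    qed
  qed (use assms in simp)
qed

text \<open>The weighted inequality with \<open>u = 1\<close>, for a generation of
  \<open>k ^ a\<close> vertices.\<close>

lemma sum_powr_le_descend:
  assumes k: "2 \<le> k" and s: "1 < s" and F: "\<And>y. 0 \<le> F y"
  shows "(\<Sum>y\<in>descend k a z. F y) powr s
    \<le> real k powr (real a * (s - 1)) * (\<Sum>y\<in>descend k a z. F y powr s)"
proof -
  have "(\<Sum>y\<in>descend k a z. F y) powr s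
      \<le> (\<Sum>y\<in>descend k a z. F y powr s * 1 powr (1 - s)) * (\<Sum>y\<in>descend k a z. 1) powr (s - 1)"
    by (rule sum_powr_le_weighted[OF s]) (use F in auto)
  also have "(\<Sum>y\<in>descend k a z. (1::real)) = real k powr real a"
    using k by (simp add: card_descend powr_realpow)
  finally show ?thesis
    by (simp add: powr_powr mult.commute)
qed

text \<open>Single terms have no decay in \<open>b\<close> here. The sum over \<open>b\<close> is
  therefore taken for fixed \<open>z\<close>, where the level \<open>l\<close> cuts off a geometric
  series.\<close>

lemma weak_type_fork_avg:
  fixes p \<delta> C l :: real
  assumes k: "2 \<le> k" and p: "1 < p" and w: "is_weight k w" and C: "0 \<le> C"
    and g: "tree_growth k p \<delta> C w" and F: "\<And>y. 0 \<le> F y" and l: "0 < l"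
  shows "(\<Sum>b. \<integral>\<^sup>+x. (if l < fork_avg k a b F x then ennreal (w x) else 0) \<partial>count_space (tree k))
    \<le> ennreal (2 * C * real k powr (- (1 - \<delta>) * real a) * l powr (- p))
       * (\<integral>\<^sup>+x. ennreal (F x powr p * w x) \<partial>count_space (tree k))"
proof -
  let ?T = "count_space (tree k)"
  define A where "A = 2 * C * real k powr (- (1 - \<delta>) * real a) * l powr (- p)"
  have A: "0 \<le> A" using C by (simp add: A_def)
  define W where "W z b x = (if l < (\<Sum>y\<in>descend k a z. F y) / real k ^ (a + b) then w x else 0)" for z b x
  have wpos: "0 < w x" if "x \<in> tree k" for x
    using w that by (simp add: is_weight_def)
  have part: "(\<Sum>b<n. \<Sum>x\<in>descend k b z. W z b x) \<le> A * (\<Sum>y\<in>descend k a z. F y powr p * w y)"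
    if z: "z \<in> tree k" for z n
  proof -
    define G where "G = (\<Sum>y\<in>descend k a z. F y)"
    have G: "0 \<le> G" unfolding G_def using F by (intro sum_nonneg) auto
    have "descend k a z \<noteq> {}"
      using card_descend[of k a z] k by auto
    \<comment> \<open>The growth bound holds for every \<open>y\<close>; with the lightest vertex
      \<open>y0\<close>, the factor \<open>w y0\<close> can be replaced by each \<open>w y\<close>
      at the end.\<close>
    then obtain y0 where y0: "y0 \<in> descend k a z" "\<And>y. y \<in> descend k a z \<Longrightarrow> w y0 \<le> w y"
      using ex_min_if_finite[of "w ` descend k a z"] by (force simp: not_less)
    have wy0: "0 < w y0"
      using wpos descend_subset_tree[OF z] y0(1) by blast
    define c where "c = real k powr p"
    define X where "X = (G / (l * real k ^ a)) powr p"
    have "real k powr 1 \<le> c"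
      unfolding c_def using k p by (intro powr_mono) auto
    then have c: "2 \<le> c" using k by simp
    \<comment> \<open>\<open>c ^ b\<close> is the factor \<open>k powr (b * p)\<close> of the growth
      bound, so the level condition cuts off the very sequence that is summed.\<close>
    have cond: "l < G / real k ^ (a + b) \<longleftrightarrow> c ^ b < X" for b
    proof -
      have "l < G / real k ^ (a + b) \<longleftrightarrow> real k ^ b < G / (l * real k ^ a)"
        using k l by (simp add: field_simps power_add)
      also have "\<dots> \<longleftrightarrow> (real k ^ b) powr p < X"
        unfolding X_def using G l p powr_mono2[of p "G / (l * real k ^ a)" "real k ^ b"]
          powr_less_mono2[of p "real k ^ b" "G / (l * real k ^ a)"]
        by (cases "real k ^ b < G / (l * real k ^ a)") (simp_all add: not_less)
      also have "(real k ^ b) powr p = c ^ b"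
        using k by (simp add: c_def powr_realpow[symmetric] powr_powr mult.commute)
      finally show ?thesis .
    qed
    have "(\<Sum>b<n. \<Sum>x\<in>descend k b z. W z b x)
        \<le> (\<Sum>b<n. C * real k powr (real a * \<delta>) * w y0 * (if c ^ b < X then c ^ b else 0))"
    proof (intro sum_mono)
      fix b
      show "(\<Sum>x\<in>descend k b z. W z b x)
        \<le> C * real k powr (real a * \<delta>) * w y0 * (if c ^ b < X then c ^ b else 0)"
      proof (cases "c ^ b < X")
        case True
        then have "(\<Sum>x\<in>descend k b z. W z b x) = (\<Sum>x\<in>descend k b z. w x)"
          using cond[of b] by (simp add: W_def G_def)
        also have "\<dots> \<le> C * real k powr (real b * p + real a * \<delta>) * w y0"
          using g z y0(1) unfolding tree_growth_def by blast
        also have "real k powr (real b * p + real a * \<delta>) = c ^ b * real k powr (real a * \<delta>)"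
          using k by (simp add: c_def powr_add powr_realpow[symmetric] powr_powr mult.commute)
        finally show ?thesis using True by (simp add: mult_ac)
      next
        case False
        then show ?thesis
          using cond[of b] by (simp add: W_def G_def)
      qed
    qed
    also have "\<dots> \<le> C * real k powr (real a * \<delta>) * w y0 * (2 * X)"
      unfolding sum_distrib_left[symmetric]
      using C wy0 by (intro mult_left_mono sum_power_below_le c) (auto simp: X_def)
    also have "\<dots> = 2 * C * real k powr (real a * \<delta>) * l powr (- p) * real k powr (- (real a * p)) * w y0 * G powr p"
    proof -
      have "(l * real k ^ a) powr p = l powr p * real k powr (real a * p)"
        using k l by (simp add: powr_mult powr_realpow[symmetric] powr_powr)
      then have "X = G powr p * l powr (- p) * real k powr (- (real a * p))"
        using k l G by (simp add: X_def powr_divide powr_minus divide_simps)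
      then show ?thesis by (simp add: mult_ac)
    qed
    also have "\<dots> \<le> 2 * C * real k powr (real a * \<delta>) * l powr (- p) * real k powr (- (real a * p)) * w y0
        * (real k powr (real a * (p - 1)) * (\<Sum>y\<in>descend k a z. F y powr p))"
      unfolding G_def using C wy0 F by (intro mult_left_mono sum_powr_le_descend k p) auto
    also have "\<dots> = A * (\<Sum>y\<in>descend k a z. F y powr p * w y0)"
    proof -
      \<comment> \<open>Per level, growth contributes \<open>\<delta>\<close>, the normalisation in
        \<open>X\<close> contributes \<open>- p\<close> and convexity \<open>p - 1\<close>.\<close>
      have "real k powr (real a * \<delta>) * real k powr (- (real a * p)) * real k powr (real a * (p - 1))
          = real k powr (- (1 - \<delta>) * real a)"
        unfolding powr_add[symmetric] by (rule arg_cong[where f = "\<lambda>t. real k powr t"]) (simp add: algebra_simps)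
      then show ?thesis
        unfolding A_def sum_distrib_right[symmetric] by (simp add: mult_ac)
    qed
    also have "\<dots> \<le> A * (\<Sum>y\<in>descend k a z. F y powr p * w y)"
      using A y0 by (intro mult_left_mono sum_mono) auto
    finally show ?thesis .
  qed
  have nn: "0 \<le> W z b x" if "x \<in> tree k" for z b x
    using wpos[OF that] by (simp add: W_def)
  have "(\<Sum>b. \<integral>\<^sup>+x. (if l < fork_avg k a b F x then ennreal (w x) else 0) \<partial>?T)
    = (\<Sum>b. \<integral>\<^sup>+x. (if b \<le> length x then ennreal (W (drop b x) b x) else 0) \<partial>?T)"
    using l by (intro suminf_cong nn_integral_cong) (auto simp: fork_avg_def W_def)
  also have "\<dots> = (\<Sum>b. \<integral>\<^sup>+z. (\<Sum>x\<in>descend k b z. ennreal (W z b x)) \<partial>?T)"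
    by (intro suminf_cong regroup_by_ancestor[where h = "\<lambda>x z. ennreal (W z b x)" for b])
  also have "\<dots> = (\<integral>\<^sup>+z. (\<Sum>b. \<Sum>x\<in>descend k b z. ennreal (W z b x)) \<partial>?T)"
    by (rule nn_integral_suminf[symmetric]) simp
  also have "\<dots> \<le> (\<integral>\<^sup>+z. ennreal A * (\<Sum>y\<in>descend k a z. ennreal (F y powr p * w y)) \<partial>?T)"
  proof (intro nn_integral_mono)
    fix z assume "z \<in> space ?T"
    then have z: "z \<in> tree k" by simp
    have nnD: "0 \<le> W z b x" "0 \<le> w x" if "x \<in> descend k c z" for b c x
      using nn wpos descend_subset_tree[OF z] that by (blast intro: less_imp_le)+
    have "(\<Sum>b. \<Sum>x\<in>descend k b z. ennreal (W z b x)) = (\<Sum>b. ennreal (\<Sum>x\<in>descend k b z. W z b x))"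
      using nnD by (intro suminf_cong sum_ennreal) auto
    also have "\<dots> \<le> ennreal (A * (\<Sum>y\<in>descend k a z. F y powr p * w y))"
    proof (intro suminf_le_const summableI)
      fix n
      have "(\<Sum>b<n. ennreal (\<Sum>x\<in>descend k b z. W z b x)) = ennreal (\<Sum>b<n. \<Sum>x\<in>descend k b z. W z b x)"
        using nnD by (intro sum_ennreal sum_nonneg) auto
      also have "\<dots> \<le> ennreal (A * (\<Sum>y\<in>descend k a z. F y powr p * w y))"
        by (rule ennreal_leI[OF part[OF z]])
      finally show "(\<Sum>b<n. ennreal (\<Sum>x\<in>descend k b z. W z b x)) \<le> ennreal (A * (\<Sum>y\<in>descend k a z. F y powr p * w y))" .
    qed
    also have "\<dots> = ennreal A * (\<Sum>y\<in>descend k a z. ennreal (F y powr p * w y))"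
      using A nnD(2) by (subst sum_ennreal) (auto intro: ennreal_mult')
    finally show "(\<Sum>b. \<Sum>x\<in>descend k b z. ennreal (W z b x))
        \<le> ennreal A * (\<Sum>y\<in>descend k a z. ennreal (F y powr p * w y))" .
  qed
  also have "\<dots> = ennreal A * (\<integral>\<^sup>+z. (\<Sum>y\<in>descend k a z. ennreal (F y powr p * w y)) \<partial>?T)"
    by (intro nn_integral_cmult) auto
  also have "\<dots> \<le> ennreal A * (\<integral>\<^sup>+x. ennreal (F x powr p * w x) \<partial>?T)"
    by (intro mult_left_mono nn_integral_sum_descend_le) auto
  finally show ?thesis
    unfolding A_def .
qed

text \<open>Where the maximal function exceeds \<open>l\<close>, some fork average exceeds a
  threshold \<open>m a\<close>. The weight of the level set is thus at most a double sum, handled in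
  \<open>b\<close> by the cut-off series and in \<open>a\<close> by geometric decay.\<close>

lemma weak_type:
  fixes p \<delta> C :: real
  assumes k: "2 \<le> k" and p: "1 < p" and w: "is_weight k w" and C: "0 < C" and \<delta>: "\<delta> < 1"
    and g: "tree_growth k p \<delta> C w"
  shows "\<exists>C::real. \<forall>f :: nat list \<Rightarrow> complex.
     weak_Lq_norm k p w (maximal_fun k f) \<le> ennreal C * Lq_norm k p w (\<lambda>x. ennreal (norm (f x)))"
proof -
  let ?T = "count_space (tree k)"
  \<comment> \<open>Lowering the threshold by \<open>k powr (\<eta> * a)\<close> costs half of the
    decay \<open>1 - \<delta>\<close> after raising to the power \<open>p\<close>.\<close>
  define \<eta> where "\<eta> = (1 - \<delta>) / (2 * p)"
  have \<eta>: "0 < \<eta>" using \<delta> p by (simp add: \<eta>_def)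
  obtain S where S: "S > 0" and pw: "\<forall>F. \<forall>x\<in>tree k. \<forall>r. (\<forall>y. 0 \<le> F y) \<longrightarrow>
       (\<exists>a b. (\<Sum>y\<in>tree_ball k x r. F y) / real (card (tree_ball k x r))
          \<le> S * real k powr (\<eta> * real a) * fork_avg k a b F x)"
    using ball_avg_le_single_fork_avg[OF k \<eta>] by (elim exE conjE) (rule that)
  have \<delta>2: "0 < (1 - \<delta>) / 2" using \<delta> by simp
  obtain G1 where G1: "0 < G1" "(\<Sum>a. ennreal (real k powr (- ((1 - \<delta>) / 2) * real a))) = ennreal G1"
    using suminf_powr_geometric[OF k \<delta>2] by blast
  define K where "K = 2 * C * S powr p * G1"
  have K: "0 < K" using C S G1 by (simp add: K_def)
  have w0: "0 \<le> w x" if "x \<in> tree k" for x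
    using w that by (simp add: is_weight_def less_imp_le)
  have main: "ennreal l * ennpowr (weight_of w {x \<in> tree k. maximal_fun k f x > ennreal l}) (1 / p)
       \<le> ennreal (K powr (1 / p)) * Lq_norm k p w (\<lambda>x. ennreal (norm (f x)))"
    if l: "0 < l" for f :: "nat list \<Rightarrow> complex" and l
  proof -
    define F where "F x = norm (f x)" for x
    have F: "0 \<le> F x" for x by (simp add: F_def)
    define I where "I = (\<integral>\<^sup>+x. ennreal (F x powr p * w x) \<partial>?T)"
    have I: "(\<integral>\<^sup>+x. ennpowr (ennreal (norm (f x))) p * ennreal (w x) \<partial>?T) = I"
      unfolding I_def by (intro nn_integral_cong) (simp add: F_def ennpowr_ennreal ennreal_mult')
    define m where "m a = l / (S * real k powr (\<eta> * real a))" for a :: nat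
    have m: "0 < m a" for a using l S k by (simp add: m_def)
    define X where "X a b x = (if m a < fork_avg k a b F x then ennreal (w x) else 0)" for a b x
    have pt: "ennreal (w x) * indicator {x \<in> tree k. maximal_fun k f x > ennreal l} x \<le> (\<Sum>a. \<Sum>b. X a b x)"
      if x: "x \<in> tree k" for x
    proof (cases "maximal_fun k f x > ennreal l")
      case True
      then obtain r where "ennreal l < ennreal ((\<Sum>y\<in>tree_ball k x r. norm (f y)) / real (card (tree_ball k x r)))"
        unfolding maximal_fun_def less_SUP_iff by blast
      then have r: "l < (\<Sum>y\<in>tree_ball k x r. norm (f y)) / real (card (tree_ball k x r))"
        using l by (simp add: ennreal_less_iff)
      have "\<exists>a b. (\<Sum>y\<in>tree_ball k x r. norm (f y)) / real (card (tree_ball k x r))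
          \<le> S * real k powr (\<eta> * real a) * fork_avg k a b F x"
        using pw[rule_format, of x F r, OF x F] by (simp only: F_def[abs_def])
      then obtain a b where "(\<Sum>y\<in>tree_ball k x r. norm (f y)) / real (card (tree_ball k x r))
          \<le> S * real k powr (\<eta> * real a) * fork_avg k a b F x"
        by blast
      with r have "l < S * real k powr (\<eta> * real a) * fork_avg k a b F x"
        by linarith
      moreover have "0 < S * real k powr (\<eta> * real a)"
        using S k by simp
      ultimately have "m a < fork_avg k a b F x"
        unfolding m_def by (subst pos_divide_less_eq) (simp_all add: mult.commute)
      then have "X a b x = ennreal (w x)" by (simp add: X_def)
      then have "ennreal (w x) \<le> (\<Sum>a. \<Sum>b. X a b x)"
        using le_double_suminf[of "\<lambda>a b. X a b x" a b] by metis
      then show ?thesis using True x by simp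
    qed simp
    have "weight_of w {x \<in> tree k. maximal_fun k f x > ennreal l}
       = (\<integral>\<^sup>+x. ennreal (w x) * indicator {x \<in> tree k. maximal_fun k f x > ennreal l} x \<partial>?T)"
    proof -
      have "(\<integral>\<^sup>+x. ennreal (w x) * indicator {x \<in> tree k. maximal_fun k f x > ennreal l} x \<partial>?T)
        = (\<integral>\<^sup>+x. ennreal (w x) * indicator {x \<in> tree k. maximal_fun k f x > ennreal l} x * indicator (tree k) x \<partial>count_space UNIV)"
        by (simp add: nn_integral_count_space_indicator)
      also have "\<dots> = (\<integral>\<^sup>+x. ennreal (w x) * indicator {x \<in> tree k. maximal_fun k f x > ennreal l} x \<partial>count_space UNIV)"
        by (intro nn_integral_cong) (auto simp: indicator_def)
      finally show ?thesis
        by (simp add: weight_of_def nn_integral_count_space_indicator)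
    qed
    also have "\<dots> \<le> (\<integral>\<^sup>+x. (\<Sum>a. \<Sum>b. X a b x) \<partial>?T)"
      by (intro nn_integral_mono pt) simp
    also have "\<dots> = (\<Sum>a. \<Sum>b. \<integral>\<^sup>+x. X a b x \<partial>?T)"
      by (simp add: nn_integral_suminf)
    also have "\<dots> \<le> (\<Sum>a. ennreal (2 * C * S powr p * l powr (- p)) * I * ennreal (real k powr (- ((1 - \<delta>) / 2) * real a)))"
    proof (intro suminf_le summableI)
      fix a
      have "(\<Sum>b. \<integral>\<^sup>+x. X a b x \<partial>?T)
          \<le> ennreal (2 * C * real k powr (- (1 - \<delta>) * real a) * m a powr (- p)) * I"
        unfolding X_def I_def by (rule weak_type_fork_avg[OF k p w less_imp_le[OF C] g F m])
      also have "2 * C * real k powr (- (1 - \<delta>) * real a) * m a powr (- p)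
        = 2 * C * S powr p * l powr (- p) * real k powr (- ((1 - \<delta>) / 2) * real a)"
      proof -
        have "(S * real k powr (\<eta> * real a)) powr p = S powr p * real k powr (\<eta> * real a * p)"
          using S by (simp only: powr_mult powr_powr less_imp_le powr_ge_zero)
        moreover have "\<eta> * real a * p = (1 - \<delta>) / 2 * real a"
          using p by (simp add: \<eta>_def)
        moreover have "m a powr (- p) = l powr (- p) * (S * real k powr (\<eta> * real a)) powr p"
          using l S k unfolding m_def by (subst powr_divide) (simp_all add: powr_minus_divide)
        ultimately have 1: "m a powr (- p) = l powr (- p) * S powr p * real k powr ((1 - \<delta>) / 2 * real a)"
          by (simp only: mult.assoc)
        have 2: "real k powr (- (1 - \<delta>) * real a) * real k powr ((1 - \<delta>) / 2 * real a)
          = real k powr (- ((1 - \<delta>) / 2) * real a)"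
          unfolding powr_add[symmetric]
          by (rule arg_cong[where f = "\<lambda>t. real k powr t"]) (simp add: field_simps)
        show ?thesis
          unfolding 1 2[symmetric] by (simp only: mult_ac)
      qed
      also have "ennreal (2 * C * S powr p * l powr (- p) * real k powr (- ((1 - \<delta>) / 2) * real a)) * I
         = ennreal (2 * C * S powr p * l powr (- p)) * I * ennreal (real k powr (- ((1 - \<delta>) / 2) * real a))"
        using C by (subst ennreal_mult) (auto simp: mult_ac)
      finally show "(\<Sum>b. \<integral>\<^sup>+x. X a b x \<partial>?T)
         \<le> ennreal (2 * C * S powr p * l powr (- p)) * I * ennreal (real k powr (- ((1 - \<delta>) / 2) * real a))" .
    qed
    also have "\<dots> = ennreal (2 * C * S powr p * l powr (- p)) * I * ennreal G1"
      by (simp only: ennreal_suminf_cmult G1(2))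
    also have "\<dots> = ennreal (K * l powr (- p)) * I"
    proof -
      have "K * l powr (- p) = 2 * C * S powr p * l powr (- p) * G1"
        by (simp add: K_def)
      then have "ennreal (K * l powr (- p)) = ennreal (2 * C * S powr p * l powr (- p)) * ennreal G1"
        using C G1(1) by (simp only:) (intro ennreal_mult, auto)
      then show ?thesis by (simp only: mult_ac)
    qed
    finally have "ennpowr (weight_of w {x \<in> tree k. maximal_fun k f x > ennreal l}) (1 / p)
        \<le> ennpowr (ennreal (K * l powr (- p)) * I) (1 / p)"
      using p by (intro ennpowr_mono) auto
    also have "\<dots> = ennreal ((K * l powr (- p)) powr (1 / p)) * ennpowr I (1 / p)"
      using K l by (intro ennpowr_mult_ennreal) auto
    \<comment> \<open>The resulting \<open>1 / l\<close> cancels the factor \<open>l\<close> in the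
      weak norm.\<close>
    also have "(K * l powr (- p)) powr (1 / p) = K powr (1 / p) / l"
    proof -
      have "(l powr (- p)) powr (1 / p) = 1 / l"
        using l p unfolding powr_powr by (simp add: powr_minus_divide)
      then show ?thesis
        using K by (simp add: powr_mult)
    qed
    finally have "ennreal l * ennpowr (weight_of w {x \<in> tree k. maximal_fun k f x > ennreal l}) (1 / p)
        \<le> ennreal l * (ennreal (K powr (1 / p) / l) * ennpowr I (1 / p))"
      by (intro mult_left_mono) auto
    also have "\<dots> = ennreal (K powr (1 / p)) * ennpowr I (1 / p)"
      using l by (simp add: mult.assoc[symmetric] ennreal_mult'[symmetric])
    finally show ?thesis
      unfolding Lq_norm_def I .
  qed
  show ?thesis
    unfolding weak_Lq_norm_def by (intro exI[of _ "K powr (1 / p)"] allI SUP_least main) simp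
qed

section \<open>Estimates for the weight and its dual\<close>

text \<open>Convexity costs \<open>k powr (a * (q - 1))\<close> and growth
  \<open>k powr (b * p + a * \<delta>)\<close>. Compared with \<open>k powr ((a + b) * q)\<close>,
  this leaves the decay rates \<open>1 - \<delta>\<close> in \<open>a\<close> and
  \<open>q - p\<close> in \<open>b\<close>.\<close>

lemma growth_strong_estimate:
  fixes p q \<delta> C :: real
  assumes k: "2 \<le> k" and pq: "1 < p" "p < q" and w: "is_weight k w" and C: "0 \<le> C"
    and g: "tree_growth k p \<delta> C w" and z: "z \<in> tree k" and F: "\<And>y. 0 \<le> F y"
  shows "(\<Sum>x\<in>descend k b z. w x * (\<Sum>y\<in>descend k a z. F y) powr q)
     \<le> C * real k powr ((real a + real b) * q - (1 - \<delta>) * real a - (q - p) * real b)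
         * (\<Sum>y\<in>descend k a z. F y powr q * w y)"
proof -
  define W where "W = (\<Sum>x\<in>descend k b z. w x)"
  have W: "0 \<le> W"
    unfolding W_def using w descend_subset_tree[OF z]
    by (intro sum_nonneg) (auto simp: is_weight_def intro: less_imp_le)
  have "(\<Sum>x\<in>descend k b z. w x * (\<Sum>y\<in>descend k a z. F y) powr q)
      = W * (\<Sum>y\<in>descend k a z. F y) powr q"
    by (simp add: W_def sum_distrib_right)
  also have "\<dots> \<le> W * (real k powr (real a * (q - 1)) * (\<Sum>y\<in>descend k a z. F y powr q))"
    using W F pq by (intro mult_left_mono sum_powr_le_descend k) auto
  also have "\<dots> = real k powr (real a * (q - 1)) * (\<Sum>y\<in>descend k a z. F y powr q * W)"
    by (simp add: sum_distrib_right[symmetric])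
  \<comment> \<open>With \<open>W\<close> inside the sum, growth applies to each \<open>y\<close>
    separately.\<close>
  also have "\<dots> \<le> real k powr (real a * (q - 1)) *
      (\<Sum>y\<in>descend k a z. F y powr q * (C * real k powr (real b * p + real a * \<delta>) * w y))"
    using g z unfolding tree_growth_def W_def by (intro mult_left_mono sum_mono) auto
  also have "\<dots> = C * (real k powr (real a * (q - 1)) * real k powr (real b * p + real a * \<delta>))
      * (\<Sum>y\<in>descend k a z. F y powr q * w y)"
    by (simp add: sum_distrib_left mult_ac)
  also have "real k powr (real a * (q - 1)) * real k powr (real b * p + real a * \<delta>)
     = real k powr ((real a + real b) * q - (1 - \<delta>) * real a - (q - p) * real b)"
    unfolding powr_add[symmetric]
    by (rule arg_cong[where f = "\<lambda>t. real k powr t"]) (simp add: algebra_simps)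
  finally show ?thesis .
qed

text \<open>Hoelder's inequality with weight \<open>w\<close> produces the sum of \<open>w\<close>
  over the generation of \<open>y\<close>. Growth with \<open>a\<close> and \<open>b\<close>
  exchanged bounds it by a multiple of \<open>w x\<close>, whose power cancels
  \<open>\<sigma> x\<close>; then only the \<open>k ^ b\<close> vertices \<open>x\<close> are
  counted.\<close>

lemma growth_dual_estimate:
  fixes p q \<delta> C :: real
  assumes k: "2 \<le> k" and pq: "1 < p" "p < q" and w: "is_weight k w" and C: "0 \<le> C"
    and g: "tree_growth k p \<delta> C w" and z: "z \<in> tree k" and F: "\<And>y. 0 \<le> F y"
  defines "q' \<equiv> q / (q - 1)" and "\<sigma> \<equiv> (\<lambda>x. w x powr (- 1 / (q - 1)))"
  shows "(\<Sum>x\<in>descend k b z. \<sigma> x * (\<Sum>y\<in>descend k a z. F y) powr q')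
     \<le> C powr (1 / (q - 1)) * real k powr ((real a + real b) * q'
           - (q - p) / (q - 1) * real a - (1 - \<delta>) / (q - 1) * real b)
         * (\<Sum>y\<in>descend k a z. F y powr q' * \<sigma> y)"
proof -
  \<comment> \<open>\<open>e = q' - 1\<close>, so \<open>\<sigma> = w powr (1 - q')\<close> is the
    factor occurring in \<open>sum_powr_le_weighted\<close>.\<close>
  define e where "e = 1 / (q - 1)"
  have e: "0 < e" using pq by (simp add: e_def)
  have q': "q' = 1 + e" using pq by (simp add: q'_def e_def field_simps)
  have \<sigma>: "\<sigma> x = w x powr (- e)" for x by (simp add: \<sigma>_def e_def)
  have wpos: "0 < w x" if "x \<in> descend k c z" for x c
    using w that descend_subset_tree[OF z] by (auto simp: is_weight_def)
  define N where "N = (\<Sum>y\<in>descend k a z. F y powr q' * \<sigma> y)"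
  have N: "0 \<le> N" unfolding N_def \<sigma> by (intro sum_nonneg) auto
  have holder: "(\<Sum>y\<in>descend k a z. F y) powr q' \<le> N * (\<Sum>y\<in>descend k a z. w y) powr e"
    using sum_powr_le_weighted[of q' "descend k a z" F w] F wpos e
    by (simp add: q' N_def \<sigma>)
  define M where "M = C * real k powr (real a * p + real b * \<delta>)"
  have M: "0 \<le> M" using C by (simp add: M_def)
  have pt: "\<sigma> x * (\<Sum>y\<in>descend k a z. F y) powr q' \<le> M powr e * N"
    if x: "x \<in> descend k b z" for x
  proof -
    have "(\<Sum>y\<in>descend k a z. w y) \<le> M * w x"
      using g z x unfolding tree_growth_def M_def by blast
    then have "(\<Sum>y\<in>descend k a z. w y) powr e \<le> (M * w x) powr e"
      using e wpos by (intro powr_mono2 sum_nonneg) (auto intro: less_imp_le)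
    also have "\<dots> = M powr e * w x powr e"
      using M wpos[OF x] by (simp add: powr_mult)
    finally have "N * (\<Sum>y\<in>descend k a z. w y) powr e \<le> N * (M powr e * w x powr e)"
      using N by (intro mult_left_mono)
    with holder have "(\<Sum>y\<in>descend k a z. F y) powr q' \<le> N * (M powr e * w x powr e)"
      by linarith
    then have "\<sigma> x * (\<Sum>y\<in>descend k a z. F y) powr q' \<le> \<sigma> x * (N * (M powr e * w x powr e))"
      unfolding \<sigma> by (intro mult_left_mono) auto
    also have "\<dots> = M powr e * N * (w x powr (- e) * w x powr e)"
      by (simp add: \<sigma>)
    also have "w x powr (- e) * w x powr e = 1"
      using wpos[OF x] by (simp add: powr_add[symmetric])
    finally show ?thesis by simp
  qed
  have "(\<Sum>x\<in>descend k b z. \<sigma> x * (\<Sum>y\<in>descend k a z. F y) powr q')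
      \<le> (\<Sum>x\<in>descend k b z. M powr e * N)"
    by (intro sum_mono pt)
  also have "\<dots> = real k powr real b * (M powr e * N)"
    using k by (simp add: card_descend powr_realpow)
  also have "M powr e = C powr e * real k powr ((real a * p + real b * \<delta>) * e)"
    using C by (simp add: M_def powr_mult powr_powr)
  also have "real k powr real b * (C powr e * real k powr ((real a * p + real b * \<delta>) * e) * N)
     = C powr e * (real k powr real b * real k powr ((real a * p + real b * \<delta>) * e)) * N"
    by simp
  also have "real k powr real b * real k powr ((real a * p + real b * \<delta>) * e)
     = real k powr ((real a + real b) * q'
           - (q - p) / (q - 1) * real a - (1 - \<delta>) / (q - 1) * real b)"
  proof -
    \<comment> \<open>The exponent \<open>b + (a * p + b * \<delta>) * e\<close> has to become
      \<open>(a + b) * (1 + e)\<close> minus the two decays.\<close>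
    have "(q - p) / (q - 1) = e * (q - 1) + e - p * e"
      by (simp only: divide_inverse e_def) (simp add: algebra_simps)
    moreover have "e * (q - 1) = 1"
      using pq by (simp add: e_def)
    ultimately have 1: "(q - p) / (q - 1) = 1 + e - p * e"
      by simp
    have 2: "(1 - \<delta>) / (q - 1) = (1 - \<delta>) * e"
      by (simp add: e_def)
    show ?thesis
      unfolding powr_add[symmetric] q' 1 2
      by (rule arg_cong[where f = "\<lambda>t. real k powr t"]) (simp add: algebra_simps)
  qed
  finally show ?thesis
    unfolding N_def e_def .
qed

section \<open>Assembly of the weak, strong and dual bounds\<close>

theorem corollary1p2:
  fixes k :: nat and p :: real and w :: "nat list \<Rightarrow> real"
  assumes "k \<ge> 2"
    and "1 < p"
    and "is_weight k w"
    and "\<exists>\<delta>::real. \<delta> < 1 \<and> (\<exists>C::real. \<forall>i j r :: nat. \<bar>int i - int j\<bar> \<le> int r \<longrightarrow>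
           (\<forall>x\<in>level k j. weight_of w (level k i \<inter> tree_sphere k x r)
              \<le> ennreal (C * real k powr ((real r + real i - real j) / 2 * (p - \<delta>))
                           * real k powr (real r * \<delta>) * w x)))"
  shows "(\<exists>C::real. \<forall>f :: nat list \<Rightarrow> complex.
            weak_Lq_norm k p w (maximal_fun k f)
              \<le> ennreal C * Lq_norm k p w (\<lambda>x. ennreal (norm (f x))))
       \<and> (\<forall>q > p.
            (\<exists>C::real. \<forall>f :: nat list \<Rightarrow> complex.
               Lq_norm k q w (maximal_fun k f)
                 \<le> ennreal C * Lq_norm k q w (\<lambda>x. ennreal (norm (f x))))
          \<and> (let q' = q / (q - 1); \<sigma> = (\<lambda>x. w x powr (- 1 / (q - 1))) in
             \<exists>C::real. \<forall>f :: nat list \<Rightarrow> complex.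
               Lq_norm k q' \<sigma> (maximal_fun k f)
                 \<le> ennreal C * Lq_norm k q' \<sigma> (\<lambda>x. ennreal (norm (f x)))))"
proof -
  note k = assms(1) and p = assms(2) and w = assms(3)
  obtain \<delta>0 C0 :: real where \<delta>0: "\<delta>0 < 1" and C0: "\<And>i j r x. \<bar>int i - int j\<bar> \<le> int r \<Longrightarrow> x \<in> level k j \<Longrightarrow>
           weight_of w (level k i \<inter> tree_sphere k x r)
              \<le> ennreal (C0 * real k powr ((real r + real i - real j) / 2 * (p - \<delta>0))
                           * real k powr (real r * \<delta>0) * w x)"
    using assms(4) by blast
  \<comment> \<open>The growth induction uses \<open>0 \<le> \<delta>\<close>. Enlarging
    \<open>\<delta>\<close> below 1 and making the constant positive only weakens the
    hypothesis.\<close>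
  define \<delta> where "\<delta> = max \<delta>0 0"
  define C1 where "C1 = max C0 1"
  have \<delta>: "0 \<le> \<delta>" "\<delta> < 1" "\<delta>0 \<le> \<delta>" and C1: "0 < C1" "C0 \<le> C1"
    using \<delta>0 by (auto simp: \<delta>_def C1_def)
  have hyp: "weight_of w (level k i \<inter> tree_sphere k x r)
              \<le> ennreal (C1 * real k powr ((real r + real i - real j) / 2 * (p - \<delta>))
                           * real k powr (real r * \<delta>) * w x)"
    if ij: "\<bar>int i - int j\<bar> \<le> int r" and x: "x \<in> level k j" for i j r x
  proof -
    have wx: "0 < w x" using w x by (simp add: is_weight_def level_tree_iff)
    \<comment> \<open>The total exponent of \<open>k\<close> has slope
      \<open>(r - i + j) / 2\<close> in \<open>\<delta>\<close>, which is nonnegative because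
      \<open>|i - j| \<le> r\<close>.\<close>
    have "(real r - real i + real j) / 2 * \<delta>0 \<le> (real r - real i + real j) / 2 * \<delta>"
      using ij \<delta> by (intro mult_left_mono) auto
    then have exp: "(real r + real i - real j) / 2 * (p - \<delta>0) + real r * \<delta>0
       \<le> (real r + real i - real j) / 2 * (p - \<delta>) + real r * \<delta>"
      by (simp add: field_simps)
    have "C0 * (real k powr ((real r + real i - real j) / 2 * (p - \<delta>0)) * real k powr (real r * \<delta>0)) * w x
      \<le> C1 * (real k powr ((real r + real i - real j) / 2 * (p - \<delta>)) * real k powr (real r * \<delta>)) * w x"
      unfolding powr_add[symmetric] using C1 wx exp k
      by (intro mult_right_mono mult_mono powr_mono) auto
    then show ?thesis
      using C0[OF ij x] by (simp only: mult.assoc) (rule order_trans[OF _ ennreal_leI])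
  qed
  define C where "C = 2 * C1"
  have C: "0 < C" using C1 by (simp add: C_def)
  have g: "tree_growth k p \<delta> C w"
    unfolding C_def using C1 by (intro tree_growthI k p w \<delta> hyp) auto
  show ?thesis
    unfolding Let_def
  proof (intro conjI allI impI)
    show "\<exists>C::real. \<forall>f :: nat list \<Rightarrow> complex.
            weak_Lq_norm k p w (maximal_fun k f)
              \<le> ennreal C * Lq_norm k p w (\<lambda>x. ennreal (norm (f x)))"
      by (rule weak_type[OF k p w C \<delta>(2) g])
    \<comment> \<open>In both strong bounds the decay rates are positive multiples of
      \<open>q - p\<close> and \<open>1 - \<delta>\<close>.\<close>
    fix q assume q: "p < q"
    show "\<exists>C::real. \<forall>f :: nat list \<Rightarrow> complex.
               Lq_norm k q w (maximal_fun k f)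
                 \<le> ennreal C * Lq_norm k q w (\<lambda>x. ennreal (norm (f x)))"
      by (rule strong_type[OF k _ w C _ _ growth_strong_estimate[OF k p q w _ g]])
        (use p q \<delta> C in auto)
    have \<sigma>: "is_weight k (\<lambda>x. w x powr (- 1 / (q - 1)))"
      using w by (auto simp: is_weight_def)
    show "\<exists>C::real. \<forall>f :: nat list \<Rightarrow> complex.
               Lq_norm k (q / (q - 1)) (\<lambda>x. w x powr (- 1 / (q - 1))) (maximal_fun k f)
                 \<le> ennreal C * Lq_norm k (q / (q - 1)) (\<lambda>x. w x powr (- 1 / (q - 1))) (\<lambda>x. ennreal (norm (f x)))"
      by (rule strong_type[OF k _ \<sigma> _ _ _ growth_dual_estimate[OF k p q w _ g]])
        (use p q \<delta> C in auto)
  qed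
qed

end
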